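(* Let $\sigma$ and $\tau$ be types of a positive integer $n$. The coefficient of $e^\otimes_\tau$ in the $e^\otimes$-expansion of $H_\sigma$ is $\sum_{T^*}\mathrm{psgn}^*(T^* )$, where the sum is over all labeled polywrapping block tabloids $T^*$ of shape $\sigma$ and content $\tau$.
   Context: **Types.** A composition is a finite (possibly empty) list $\beta$ of positive integers, with $\mathrm{area}(\beta)$ the sum of its entries and $\ell(\beta)$ its length. A partition is a weakly decreasing composition; $\mathrm{sort}(\beta)$ is the partition obtained by sorting $\beta$. An ordered type of $n$ is a sequence $\delta=(\delta|_1,\delta|_2,\ldots)$ of compositions with $\sum_i i\,\mathrm{area}(\delta|_i)=n$, written $\delta=1^{\delta|_1}2^{\delta|_2}\cdots$; $\ell(\delta)=\sum_i\ell(\delta|_i)$ and $\mathrm{area}(\delta)=\sum_i\mathrm{area}(\delta|_i)$. A type is an ordered type with all $\delta|_i$ partitions, and $\mathrm{psort}(\delta)$ is the type obtained by replacing each $\delta|_i$ by $\mathrm{sort}(\delta|_i)$. A block $d^r$ ($d,r\ge1$) is the ordered type with $\delta|_d=(r)$ and all other $\delta|_i$ empty. A type $\tau$ is identified with the multiset of its blocks (one copy of $d^r$ for each part $r$ of $\tau|_d$), and we list its blocks as $d_1^{r_1}\cdots d_k^{r_k}$. An $r$-ordered type is an ordered type $\delta$ with $\mathrm{area}(\delta|_i)$ divisible by $r$ for all $i$; $\mathrm{OTyp}_r(n)$ is the set of $r$-ordered types of $n$. **Polysymmetric functions.** Let $x_{ij}$ ($i,j\ge1$) be commuting indeterminates with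 $\deg x_{ij}=i$. $\mathrm{PSym}$ is the $\mathbb{Q}$-algebra of bounded-degree formal power series in the $x_{ij}$ invariant under swapping $x_{ij}$ and $x_{ik}$ for all $i,j,k$; $\mathrm{PSym}(n)$ is its degree $n$ part. For an ordered type $\delta$, $e^\otimes_\delta=\prod_i e_{\delta|_i}(x_{i1},x_{i2},\ldots)$ where $e_\beta=\prod_j e_{\beta_j}$; $\{e^\otimes_\tau\}$ over types $\tau$ of $n$ is a basis of $\mathrm{PSym}(n)$, and the $e^\otimes$-expansion is the expansion in this basis. $H_d$ is the sum of all monomials of degree $d$ in the $x_{ij}$; $H_{d^r}$ is obtained from $H_d$ by replacing each $x_{ij}$ by $x_{ij}^r$; $H_\sigma=\prod_{i=1}^kH_{d_i^{r_i}}$ for $\sigma=d_1^{r_1}\cdots d_k^{r_k}$. **The function $\hat{s}_r$.** For an $r$-tuple $w=(w_0,\ldots,w_{r-1})$ of non-negative integers, let $v_i$ be the remainder of $w_i+i$ upon division by $r$; $\hat{s}_r(w)=(-1)^{\#\{i<j:\,v_i>v_j\}}$ if the $v_i$ are distinct, and $0$ otherwise. For a composition $\beta$ with $\ell(\beta)\le r$, $\hat{s}_r(\beta)=\sum_w\hat{s}_r(w)$ over all $r$-tuples $w$ of non-negative integers that become $\beta$ on deleting zeros; if $\ell(\beta)>r$, $\hat{s}_r(\beta)=0$. For an ordered type $\delta$, $\hat{s}_r(\delta)=\prod_i\hat{s}_r(\delta|_i)$. **Wrappings and polywrappings.** View the block $d^r$ as an array of boxes with $d$ rows and $r$ columns.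 For $k\mid d$, divide the rows from top to bottom into $d/k$ "$k$-sheets" of $k$ consecutive rows; list the $dr/k$ columns of $k$-sheets in reading order (first sheet left to right, then second sheet left to right, etc.). For a composition $\beta=(\beta_1,\ldots,\beta_l)$ of $dr/k$, the $k$-wrapping of $d^r$ of content $\beta$ is the set partition $(B_1,\ldots,B_l)$ of the boxes where $B_1$ is the first $\beta_1$ sheet-columns, $B_2$ the next $\beta_2$, etc.; the $B_j$ are called rectangles of height $k$. Given $\gamma\in\mathrm{OTyp}_r(dr)$, the polywrapping $D$ of $d^r$ of ordered content $\gamma$ is obtained by dividing the $d$ rows, from top to bottom for $k=1,2,\ldots$, into consecutive groups of $k\,\mathrm{area}(\gamma|_k)/r$ rows, and putting on the $k$th group the $k$-wrapping $D_k$ of content $\gamma|_k$. **Labeled polywrappings.** A labeled polywrapping $D^*$ of $d^r$ of ordered content $\mathrm{pocon}(D^* )=\gamma$ is the polywrapping $D$ of ordered content $\gamma$ together with, for each $k$, a labeling of the rectangles of height $k$ by labels from $\{1,\ldots,r\}$ such that, reading the rectangles $B_1,B_2,\ldots$ of $D_k$ in order, the labels start at $1$, weakly increase, and use consecutive values (not all values in $\{1,\ldots,r\}$ need occur). The ordered type of the labeling is the ordered type $\delta$ for which the $i$th entry of $\delta|_k$ is the total number of boxes in the height-$k$ rectangles labeled $i$, divided by $k$. Set $\mathrm{psgn}^*(D^* )=(-1)^{\mathrm{area}(\gamma)-\ell(\gamma)}\hat{s}_r(\delta)$. **Labeled polywrapping block tabloids.** A labeled polywrapping block tabloid $T^*$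 of shape $\sigma=d_1^{r_1}\cdots d_k^{r_k}$ and content $\tau$ is a list $(D^*_{(1)},\ldots,D^*_{(k)})$ where $D^*_{(i)}$ is a labeled polywrapping of $d_i^{r_i}$ and the multiset union of the blocks of $\mathrm{psort}(\mathrm{pocon}(D^*_{(i)}))$, $1\le i\le k$, equals $\tau$. Set $\mathrm{psgn}^*(T^* )=\prod_{i=1}^k\mathrm{psgn}^*(D^*_{(i)})$. *)

theory Defs
  imports Complex_Main "HOL-Library.Multiset" "HOL-Library.Poly_Mapping"
begin

text \<open>
  A monomial in variables from \<open>'v\<close> is a finitely supported exponent function.
\<close>

typedef (overloaded) ('v, 'a) mfps = "UNIV :: (('v \<Rightarrow>\<^sub>0 nat) \<Rightarrow> 'a) set"
  morphisms mfps_nth Abs_mfps ..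

setup_lifting type_definition_mfps

lemma mfps_eqI: "(\<And>m. mfps_nth f m = mfps_nth g m) \<Longrightarrow> f = g"
  by (metis ext mfps_nth_inject)

lemma mfps_nth_Abs [simp]: "mfps_nth (Abs_mfps f) = f"
  by (simp add: Abs_mfps_inverse)

lemma finite_monomial_summands:
  fixes m :: "'v \<Rightarrow>\<^sub>0 nat"
  shows "finite {(a, b). a + b = m}"
proof -
  let ?K = "Poly_Mapping.keys m"
  let ?B = "{..(\<Sum>x\<in>?K. Poly_Mapping.lookup m x)}"
  let ?S = "{a. \<exists>b. a + b = m}"
  have "Poly_Mapping.lookup ` ?S \<subseteq> {f. \<forall>x. (x \<in> ?K \<longrightarrow> f x \<in> ?B) \<and> (x \<notin> ?K \<longrightarrow> f x = 0)}"
  proof safe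
    fix a b :: "'v \<Rightarrow>\<^sub>0 nat" and x
    assume "x \<in> Poly_Mapping.keys (a + b)"
    then have "Poly_Mapping.lookup (a + b) x
        \<le> (\<Sum>x\<in>Poly_Mapping.keys (a + b). Poly_Mapping.lookup (a + b) x)"
      by (intro member_le_sum) auto
    then show "Poly_Mapping.lookup a x
        \<le> (\<Sum>x\<in>Poly_Mapping.keys (a + b). Poly_Mapping.lookup (a + b) x)"
      by (simp add: lookup_add)
  next
    fix a b :: "'v \<Rightarrow>\<^sub>0 nat" and x
    assume "x \<notin> Poly_Mapping.keys (a + b)"
    then show "Poly_Mapping.lookup a x = 0"
      by (simp add: in_keys_iff lookup_add)
  qed
  moreover have "finite {f. \<forall>x. (x \<in> ?K \<longrightarrow> f x \<in> ?B) \<and> (x \<notin> ?K \<longrightarrow> f x = 0)}"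
    by (intro finite_set_of_finite_funs) auto
  ultimately have "finite (Poly_Mapping.lookup ` ?S)"
    by (rule finite_subset)
  then have "finite ?S"
    by (rule finite_imageD) (meson inj_onI lookup_inject)
  moreover have "{(a, b). a + b = m} \<subseteq> (\<lambda>a. (a, m - a)) ` ?S"
    by force
  ultimately show ?thesis
    by (meson finite_imageI finite_subset)
qed

lemma sum_monomial_split_triple:
  fixes F :: "('v \<Rightarrow>\<^sub>0 nat) \<Rightarrow> ('v \<Rightarrow>\<^sub>0 nat) \<Rightarrow> ('v \<Rightarrow>\<^sub>0 nat) \<Rightarrow> 'a::comm_monoid_add"
  shows "(\<Sum>(p, c) \<in> {(p, c). p + c = m}. \<Sum>(a, b) \<in> {(a, b). a + b = p}. F a b c) =
         (\<Sum>(a, q) \<in> {(a, q). a + q = m}. \<Sum>(b, c) \<in> {(b, c). b + c = q}. F a b c)"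
proof -
  note fin = finite_monomial_summands [unfolded split_def]
  have "(\<Sum>(p, c) \<in> {(p, c). p + c = m}. \<Sum>(a, b) \<in> {(a, b). a + b = p}. F a b c) =
    (\<Sum>x \<in> (SIGMA x:{(p, c). p + c = m}. {(a, b). a + b = fst x}).
       F (fst (snd x)) (snd (snd x)) (snd (fst x)))"
    using sum.Sigma [of "{(p, c). p + c = m}" "\<lambda>x. {(a, b). a + b = fst x}"
        "\<lambda>x y. F (fst y) (snd y) (snd x)"] by (simp add: split_def fin)
  also have "\<dots> = (\<Sum>x \<in> (SIGMA x:{(a, q). a + q = m}. {(b, c). b + c = snd x}).
       F (fst (fst x)) (fst (snd x)) (snd (snd x)))"
    by (rule sum.reindex_bij_witness
        [where i = "\<lambda>((a, q), (b, c)). ((a + b, c), (a, b))"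
           and j = "\<lambda>((p, c), (a, b)). ((a, b + c), (b, c))"])
      (auto simp: add.assoc)
  also have "\<dots> = (\<Sum>(a, q) \<in> {(a, q). a + q = m}. \<Sum>(b, c) \<in> {(b, c). b + c = q}. F a b c)"
    using sum.Sigma [of "{(a, q). a + q = m}" "\<lambda>x. {(b, c). b + c = snd x}"
        "\<lambda>x y. F (fst x) (fst y) (snd y)"] by (simp add: split_def fin)
  finally show ?thesis .
qed

instantiation mfps :: (type, comm_ring_1) comm_ring_1
begin

lift_definition zero_mfps :: "('a, 'b) mfps" is "\<lambda>_. 0" .
lift_definition one_mfps :: "('a, 'b) mfps" is "\<lambda>m. if m = 0 then 1 else 0" .
lift_definition plus_mfps :: "('a, 'b) mfps \<Rightarrow> ('a, 'b) mfps \<Rightarrow> ('a, 'b) mfps"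
  is "\<lambda>f g m. f m + g m" .
lift_definition uminus_mfps :: "('a, 'b) mfps \<Rightarrow> ('a, 'b) mfps" is "\<lambda>f m. - f m" .
lift_definition minus_mfps :: "('a, 'b) mfps \<Rightarrow> ('a, 'b) mfps \<Rightarrow> ('a, 'b) mfps"
  is "\<lambda>f g m. f m - g m" .
lift_definition times_mfps :: "('a, 'b) mfps \<Rightarrow> ('a, 'b) mfps \<Rightarrow> ('a, 'b) mfps"
  is "\<lambda>f g m. \<Sum>(a, b) \<in> {(a, b). a + b = m}. f a * g b" .

instance
proof
  fix f g h :: "('a, 'b) mfps"
  show "f * g * h = f * (g * h)"
  proof (rule mfps_eqI)
    fix m
    have "mfps_nth (f * g * h) m =
      (\<Sum>(p, c) \<in> {(p, c). p + c = m}. \<Sum>(a, b) \<in> {(a, b). a + b = p}.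
         mfps_nth f a * mfps_nth g b * mfps_nth h c)"
      by (simp add: times_mfps.rep_eq sum_distrib_right split_def)
    also have "\<dots> = (\<Sum>(a, q) \<in> {(a, q). a + q = m}. \<Sum>(b, c) \<in> {(b, c). b + c = q}.
         mfps_nth f a * mfps_nth g b * mfps_nth h c)"
      by (rule sum_monomial_split_triple)
    also have "\<dots> = mfps_nth (f * (g * h)) m"
      by (simp add: times_mfps.rep_eq sum_distrib_left split_def mult.assoc)
    finally show "mfps_nth (f * g * h) m = mfps_nth (f * (g * h)) m" .
  qed
  show "f * g = g * f"
  proof (rule mfps_eqI)
    fix m
    show "mfps_nth (f * g) m = mfps_nth (g * f) m"
      unfolding times_mfps.rep_eq
      by (rule sum.reindex_bij_witness [where i = prod.swap and j = prod.swap])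
        (auto simp: add.commute mult.commute)
  qed
  show "1 * f = f"
  proof (rule mfps_eqI)
    fix m
    have "mfps_nth (1 * f) m =
        (\<Sum>x \<in> {(a, b). a + b = m}. if x = (0, m) then mfps_nth f m else 0)"
      unfolding times_mfps.rep_eq by (rule sum.cong) (auto simp: one_mfps.rep_eq split: if_splits)
    also have "\<dots> = mfps_nth f m"
      by (subst sum.delta) (auto simp: finite_monomial_summands)
    finally show "mfps_nth (1 * f) m = mfps_nth f m" .
  qed
  show "(f + g) * h = f * h + g * h"
    by (rule mfps_eqI)
      (simp add: times_mfps.rep_eq plus_mfps.rep_eq distrib_right sum.distrib split_def)
  show "(0 :: ('a, 'b) mfps) \<noteq> 1"
    by (metis one_mfps.rep_eq zero_mfps.rep_eq zero_neq_one)
qed (transfer; simp add: algebra_simps)+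

end

lift_definition mfps_scale :: "'a::comm_ring_1 \<Rightarrow> ('v, 'a) mfps \<Rightarrow> ('v, 'a) mfps"
  is "\<lambda>c f m. c * f m" .

text \<open>The variable $x_{ij}$ is the pair \<open>(i, j)\<close>.\<close>

type_synonym pseries = "(nat \<times> nat, rat) mfps"

global_interpretation pseries: vector_space "mfps_scale :: rat \<Rightarrow> pseries \<Rightarrow> pseries"
  by unfold_locales (transfer; simp add: algebra_simps)+

text \<open>The area of a composition is \<^const>\<open>sum_list\<close>.\<close>

definition composition :: "nat list \<Rightarrow> bool"
  where "composition \<beta> \<longleftrightarrow> 0 \<notin> set \<beta>"

text \<open>
  An ordered type is a function on positive indices; the unused index 0 is
  pinned to the empty list, so that equality of functions is equality of ordered types.
\<close>

type_synonym otype = "nat \<Rightarrow> nat list"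

definition supp :: "otype \<Rightarrow> nat set"
  where "supp \<delta> = {i. \<delta> i \<noteq> []}"

definition OTyp :: "nat \<Rightarrow> otype set"
  where "OTyp n = {\<delta>. \<delta> 0 = [] \<and> (\<forall>i. composition (\<delta> i)) \<and> finite (supp \<delta>) \<and>
                      (\<Sum>i\<in>supp \<delta>. i * sum_list (\<delta> i)) = n}"

definition r_OTyp :: "nat \<Rightarrow> nat \<Rightarrow> otype set"
  where "r_OTyp r n = {\<delta> \<in> OTyp n. \<forall>i. r dvd sum_list (\<delta> i)}"

definition Typ :: "nat \<Rightarrow> otype set"
  where "Typ n = {\<delta> \<in> OTyp n. \<forall>i. sorted_wrt (\<ge>) (\<delta> i)}"

definition olength :: "otype \<Rightarrow> nat"
  where "olength \<delta> = (\<Sum>i\<in>supp \<delta>. length (\<delta> i))"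

definition oarea :: "otype \<Rightarrow> nat"
  where "oarea \<delta> = (\<Sum>i\<in>supp \<delta>. sum_list (\<delta> i))"

definition psort :: "otype \<Rightarrow> otype"
  where "psort \<delta> = (\<lambda>i. rev (sort (\<delta> i)))"

text \<open>The block $d^r$ is the pair \<open>(d, r)\<close>.\<close>

definition blocks :: "otype \<Rightarrow> (nat \<times> nat) multiset"
  where "blocks \<tau> = (\<Sum>d\<in>supp \<tau>. image_mset (Pair d) (mset (\<tau> d)))"

definition pvars :: "(nat \<times> nat) set"
  where "pvars = {(i, j). i \<ge> 1 \<and> j \<ge> 1}"

definition pdegree :: "(nat \<times> nat \<Rightarrow>\<^sub>0 nat) \<Rightarrow> nat"
  where "pdegree m = (\<Sum>v\<in>Poly_Mapping.keys m. fst v * Poly_Mapping.lookup m v)"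

text \<open>The elementary symmetric function $e_k(x_{i1}, x_{i2}, \ldots)$.\<close>

definition elem_sym :: "nat \<Rightarrow> nat \<Rightarrow> pseries"
  where "elem_sym i k = Abs_mfps (\<lambda>m.
     if Poly_Mapping.keys m \<subseteq> {i} \<times> {1..} \<and> card (Poly_Mapping.keys m) = k \<and>
        (\<forall>v\<in>Poly_Mapping.keys m. Poly_Mapping.lookup m v = 1)
     then 1 else 0)"

definition etensor :: "otype \<Rightarrow> pseries"
  where "etensor \<delta> = (\<Prod>i\<in>supp \<delta>. prod_list (map (elem_sym i) (\<delta> i)))"

definition H :: "nat \<Rightarrow> pseries"
  where "H d = Abs_mfps (\<lambda>m.
     if Poly_Mapping.keys m \<subseteq> pvars \<and> pdegree m = d then 1 else 0)"

text \<open>The substitution $x_v \mapsto x_v^r$ in all variables, for $r \ge 1$.\<close>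

definition subst_powers :: "nat \<Rightarrow> pseries \<Rightarrow> pseries"
  where "subst_powers r f = Abs_mfps (\<lambda>m.
     if \<forall>v. r dvd Poly_Mapping.lookup m v
     then mfps_nth f (Poly_Mapping.map (\<lambda>e. e div r) m) else 0)"

definition H_block :: "nat \<times> nat \<Rightarrow> pseries"
  where "H_block = (\<lambda>(d, r). subst_powers r (H d))"

definition H_type :: "otype \<Rightarrow> pseries"
  where "H_type \<sigma> = (\<Prod>b\<in>#blocks \<sigma>. H_block b)"

text \<open>The coefficient of $e^\otimes_\tau$ in the expansion of \<open>f\<close> in the basis
  $e^\otimes_\rho$, where $\rho$ ranges over the types of \<open>n\<close>. These span
  $\mathrm{PSym}(n)$ as a subspace of \<^typ>\<open>pseries\<close>, so the expansion can be taken
  in the ambient vector space.\<close>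

definition etensor_coeff :: "nat \<Rightarrow> pseries \<Rightarrow> otype \<Rightarrow> rat"
  where "etensor_coeff n f \<tau> = pseries.representation (etensor ` Typ n) f (etensor \<tau>)"

text \<open>Tuples are 0-indexed lists, so \<open>r\<close> is the length of \<open>w\<close>.\<close>

definition shat_tuple :: "nat list \<Rightarrow> int"
  where "shat_tuple w =
    (let r = length w; v = (\<lambda>i. (w ! i + i) mod r)
     in if inj_on v {..<r}
        then (-1) ^ card {(i, j). i < j \<and> j < r \<and> v i > v j} else 0)"

definition shat :: "nat \<Rightarrow> nat list \<Rightarrow> int"
  where "shat r \<beta> =
    (if length \<beta> \<le> r
     then \<Sum>w | length w = r \<and> filter (\<lambda>x. x \<noteq> 0) w = \<beta>. shat_tuple w
     else 0)"

text \<open>Indices outside the support contribute the factor \<open>shat r [] = 1\<close>.\<close>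

definition shat_otype :: "nat \<Rightarrow> otype \<Rightarrow> int"
  where "shat_otype r \<delta> = (\<Prod>i\<in>supp \<delta>. shat r (\<delta> i))"

text \<open>A box is a pair of a row and a column, both counted from 0.\<close>

type_synonym box = "nat \<times> nat"

text \<open>The columns of \<open>k\<close>-sheets, in reading order, of the array of \<open>N\<close> rows
  and \<open>r\<close> columns whose top row has index \<open>a\<close>; here \<open>k\<close> divides \<open>N\<close>.\<close>

definition sheet_columns :: "nat \<Rightarrow> nat \<Rightarrow> nat \<Rightarrow> nat \<Rightarrow> box set list"
  where "sheet_columns a N r k =
    concat (map (\<lambda>s. map (\<lambda>c. {a + s * k ..< a + Suc s * k} \<times> {c}) [0..<r]) [0..<N div k])"

fun chop :: "nat list \<Rightarrow> 'a list \<Rightarrow> 'a list list"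
  where
    "chop [] xs = []"
  | "chop (b # bs) xs = take b xs # chop bs (drop b xs)"

definition wrapping :: "nat \<Rightarrow> nat \<Rightarrow> nat \<Rightarrow> nat \<Rightarrow> nat list \<Rightarrow> box set list"
  where "wrapping a N r k \<beta> = map (\<lambda>cs. \<Union>(set cs)) (chop \<beta> (sheet_columns a N r k))"

text \<open>\<open>polywrapping r \<gamma> k\<close> lists the rectangles of height \<open>k\<close> of the
  polywrapping of $d^r$ of ordered content \<open>\<gamma>\<close>. The number \<open>d\<close> of rows is
  determined by \<open>\<gamma>\<close>.\<close>

definition group_rows :: "nat \<Rightarrow> otype \<Rightarrow> nat \<Rightarrow> nat"
  where "group_rows r \<gamma> k = k * (sum_list (\<gamma> k) div r)"

definition polywrapping :: "nat \<Rightarrow> otype \<Rightarrow> nat \<Rightarrow> box set list"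
  where "polywrapping r \<gamma> k =
    wrapping (\<Sum>j<k. group_rows r \<gamma> j) (group_rows r \<gamma> k) r k (\<gamma> k)"

record lpw =
  pocon :: otype
  rects :: "nat \<Rightarrow> box set list"
  labels :: "nat \<Rightarrow> nat list"

definition valid_labels :: "nat \<Rightarrow> nat list \<Rightarrow> bool"
  where "valid_labels r L \<longleftrightarrow> sorted L \<and> (\<exists>m\<le>r. set L = {1..m})"

definition labeled_polywrappings :: "nat \<times> nat \<Rightarrow> lpw set"
  where "labeled_polywrappings = (\<lambda>(d, r). {D.
     pocon D \<in> r_OTyp r (d * r) \<and>
     rects D = polywrapping r (pocon D) \<and>
     (\<forall>k. length (labels D k) = length (rects D k) \<and> valid_labels r (labels D k))})"

definition label_otype :: "lpw \<Rightarrow> otype"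
  where "label_otype D = (\<lambda>k.
     map (\<lambda>i. (\<Sum>j | j < length (labels D k) \<and> labels D k ! j = i. card (rects D k ! j)) div k)
         [1..<Suc (card (set (labels D k)))])"

definition psgn_lpw :: "nat \<times> nat \<Rightarrow> lpw \<Rightarrow> int"
  where "psgn_lpw = (\<lambda>(d, r) D.
     (-1) ^ (oarea (pocon D) - olength (pocon D)) * shat_otype r (label_otype D))"

definition tabloids :: "(nat \<times> nat) list \<Rightarrow> otype \<Rightarrow> lpw list set"
  where "tabloids bs \<tau> = {T.
     list_all2 (\<lambda>b D. D \<in> labeled_polywrappings b) bs T \<and>
     (\<Sum>D\<leftarrow>T. blocks (psort (pocon D))) = blocks \<tau>}"

definition psgn_tabloid :: "(nat \<times> nat) list \<Rightarrow> lpw list \<Rightarrow> int"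
  where "psgn_tabloid bs T = prod_list (map2 psgn_lpw bs T)"

end

theory Submission
  imports Defs "HOL-Library.FuncSet" "HOL-Library.Product_Lexorder"
begin

text \<open>
  Since $\sum_d H_{d^r} t^d = \prod_{i,j} (1 - x_{ij}^r t^i)^{-1}$, the series $H_{d^r}$ is a sum of
  products over $i$ of plethysms $p_r[h_m]$ in the variables $x_{i1}, x_{i2}, \ldots$.
  The key identity is $p_r[h_m] = \sum_w \hat{s}_r(w) h_{w_0} \cdots h_{w_{r-1}}$ over $r$-tuples $w$
  of sum $rm$; monomial by monomial it says that adding all tuples of sum $c$ to the argument of the
  sign function multiplies it by 1 if $r \mid c$ and by 0 otherwise. Expanding
  $h_a = \sum_\beta (-1)^{a - \ell(\beta)} e_\beta$ then turns the nonzero entries of $w$ into the labels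
  of the rectangles of one height, so $H_{d^r} = \sum_D \mathrm{psgn}^*(D)\, e^\otimes_{\mathrm{pocon}(D)}$
  over labeled polywrappings. The $e^\otimes_\tau$ are linearly independent because their
  lexicographically leading monomials are distinct.
\<close>

section \<open>Sums over splittings and the sign function\<close>

text \<open>The shift by \<open>i\<close> inside the sign function normalises it: at
  \<open>w = 0\<close> the residues are \<open>0, ..., r - 1\<close> and the sign is 1. The
  coefficient of a monomial \<open>m\<close> in the sum over \<open>w\<close> is a sum over all
  distributions of \<open>m\<close> over \<open>r\<close> slots, where the slot degrees are added to
  the starting vector \<open>0, ..., r - 1\<close>. Each variable distributes its exponent
  independently of the others, so \<open>m\<close> acts by composing one operator per variable, and
  each operator is the scalar 0 or 1; exactly the monomials with all exponents divisible by
  \<open>r\<close> survive. For this composition the scalar law must hold for every starting vector,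
  not only for the first one. The product over infinitely many \<open>i\<close> is never formed: at
  monomials of degree \<open>dr\<close> the factors with \<open>1 \<le> i \<le> dr\<close>, each
  truncated at \<open>dr\<close>, already give the right coefficient. In the final step types enter
  only through their multisets of blocks, since these determine \<open>etensor\<close>.\<close>

definition splits :: "'i set \<Rightarrow> 'b::comm_monoid_add \<Rightarrow> ('i \<Rightarrow> 'b) set"
  where "splits I c = {q. (\<forall>i. i \<notin> I \<longrightarrow> q i = 0) \<and> sum q I = c}"

lemma splits_empty: "splits {} c = (if c = 0 then {\<lambda>_. 0} else {})"
  by (auto simp: splits_def)

lemma sum_fun_upd:
  "i \<notin> I \<Longrightarrow> (\<Sum>j\<in>I. if j = i then a else q j) = sum q I"
  by (rule sum.cong) auto

text \<open>Peels off one index: \<open>a\<close> is the value at \<open>i\<close>, \<open>b\<close>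
  the total left for \<open>I\<close>. Because splittings vanish outside their index set, resetting
  the value at \<open>i\<close> to 0 inverts the update.\<close>

lemma sum_splits_insert:
  fixes c :: "'b::cancel_comm_monoid_add"
  assumes "finite I" "i \<notin> I" "finite {(a, b). a + b = c}" "\<And>b::'b. finite (splits I b)"
  shows "sum F (splits (insert i I) c) = (\<Sum>(a, b)\<in>{(a, b). a + b = c}. \<Sum>q\<in>splits I b. F (q(i := a)))"
    and "finite (splits (insert i I) c)"
proof -
  let ?S = "Sigma {(a, b). a + b = c} (\<lambda>x. splits I (snd x))"
  have bij: "bij_betw (\<lambda>((a, b), q). q(i := a)) ?S (splits (insert i I) c)"
    by (rule bij_betw_byWitness[where f' = "\<lambda>q. ((q i, sum q I), q(i := 0))"])
      (use assms(1,2) in \<open>auto simp: splits_def sum_fun_upd fun_eq_iff split: if_splits\<close>)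
  have fin: "finite ?S"
    using assms(3,4) by (intro finite_SigmaI) (auto split: prod.splits)
  show "finite (splits (insert i I) c)"
    using bij fin bij_betw_finite by blast
  show "sum F (splits (insert i I) c) = (\<Sum>(a, b)\<in>{(a, b). a + b = c}. \<Sum>q\<in>splits I b. F (q(i := a)))"
    unfolding sum.reindex_bij_betw[OF bij, symmetric]
    using assms(3,4) by (simp add: sum.Sigma case_prod_beta)
qed

lemma finite_splits:
  fixes c :: "'b::cancel_comm_monoid_add"
  assumes "finite I" "\<And>c::'b. finite {(a, b). a + b = c}"
  shows "finite (splits I c)"
  using assms(1)
proof (induction I arbitrary: c)
  case empty
  then show ?case by (simp add: splits_empty)
next
  case (insert i I)
  then show ?case by (intro sum_splits_insert assms(2)) auto
qed

lemma finite_nat_summands: "finite {(a, b). a + b = (c::nat)}"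
  by (rule finite_subset[of _ "{..c} \<times> {..c}"]) auto

lemmas finite_nat_splits = finite_splits[OF _ finite_nat_summands]
lemmas finite_monomial_splits = finite_splits[OF _ finite_monomial_summands]

section \<open>Coefficients of sums, integer multiples and finite products\<close>

lemma nth_sum: "mfps_nth (sum f A) m = (\<Sum>x\<in>A. mfps_nth (f x) m)"
  by (induction A rule: infinite_finite_induct) (auto simp: zero_mfps.rep_eq plus_mfps.rep_eq)

lemma scale_eq_times: "mfps_scale c f = mfps_scale c 1 * f"
proof (rule mfps_eqI)
  fix m
  have "mfps_nth (mfps_scale c 1 * f) m =
      (\<Sum>x \<in> {(a, b). a + b = m}. if x = (0, m) then c * mfps_nth f m else 0)"
    unfolding times_mfps.rep_eq
    by (rule sum.cong) (auto simp: one_mfps.rep_eq mfps_scale.rep_eq split: if_splits)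
  also have "\<dots> = c * mfps_nth f m"
    by (subst sum.delta) (auto simp: finite_monomial_summands)
  finally show "mfps_nth (mfps_scale c f) m = mfps_nth (mfps_scale c 1 * f) m"
    by (simp add: mfps_scale.rep_eq)
qed

text \<open>Signs are integers embedded in the ring of series, whereas coefficients in a basis refer
  to scalar multiplication; this connects the two.\<close>

lemma of_int_eq_scale: "of_int k = mfps_scale (of_int k) (1 :: ('v, 'a::comm_ring_1) mfps)"
proof -
  have *: "of_nat n = mfps_scale (of_nat n) (1 :: ('v, 'a) mfps)" for n
    by (induction n) (transfer; auto simp: fun_eq_iff algebra_simps)+
  show ?thesis
  proof (cases k rule: int_cases)
    case (neg n)
    have "of_int k = - (of_nat (Suc n) :: ('v, 'a) mfps)"
      using neg by simp
    also have "\<dots> = mfps_scale (of_int k) 1"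
      unfolding * neg by transfer (auto simp: fun_eq_iff algebra_simps)
    finally show ?thesis .
  qed (simp add: *)
qed

lemma scale_of_int: "mfps_scale (of_int k) f = of_int k * f"
  by (metis of_int_eq_scale scale_eq_times)

lemma nth_of_int_times: "mfps_nth (of_int k * f) m = of_int k * mfps_nth f m"
  by (metis mfps_scale.rep_eq scale_of_int)

lemma nth_prod:
  assumes "finite I"
  shows "mfps_nth (prod f I) m = (\<Sum>q\<in>splits I m. \<Prod>i\<in>I. mfps_nth (f i) (q i))"
  using assms
proof (induction I arbitrary: m)
  case empty
  then show ?case by (simp add: splits_empty one_mfps.rep_eq)
next
  case (insert i I)
  have eq: "(\<Prod>j\<in>I. mfps_nth (f j) (if j = i then a else q j)) = (\<Prod>j\<in>I. mfps_nth (f j) (q j))" for q a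
    using insert.hyps by (intro prod.cong) auto
  show ?case
    using insert.hyps
    by (simp add: times_mfps.rep_eq insert.IH sum_distrib_left eq
        sum_splits_insert(1)[OF insert.hyps finite_monomial_summands finite_monomial_splits[OF insert.hyps(1)]])
qed

text \<open>The sign of the residues of \<open>v\<close> modulo \<open>r\<close> as an alternating
  product; \<open>sgn 0 = 0\<close> covers repeated residues without a case distinction. The index
  shift of \<open>shat_tuple\<close> is left to the argument, so that arbitrary tuples can be added
  to it.\<close>

definition chi :: "nat \<Rightarrow> (nat \<Rightarrow> nat) \<Rightarrow> int"
  where "chi r v = (\<Prod>(i, j) | i < j \<and> j < r. sgn (int (v j mod r) - int (v i mod r)))"

lemma finite_pairs: "finite {(i, j). i < j \<and> j < (r::nat)}"
  by (rule finite_subset[of _ "{..<r} \<times> {..<r}"]) auto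

lemma chi_cong: "(\<And>i. i < r \<Longrightarrow> v i mod r = w i mod r) \<Longrightarrow> chi r v = chi r w"
  unfolding chi_def by (rule prod.cong) auto

lemma chi_zero:
  assumes "i < r" "j < r" "i \<noteq> j" "v i mod r = v j mod r"
  shows "chi r v = 0"
proof -
  have "(min i j, max i j) \<in> {(i, j). i < j \<and> j < r}"
    using assms by auto
  moreover have "v (min i j) mod r = v (max i j) mod r"
    using assms by (auto simp: min_def max_def)
  ultimately show ?thesis
    unfolding chi_def using finite_pairs[of r]
    by (intro prod_zero bexI[of _ "(min i j, max i j)"]) auto
qed

lemma inj_on_of_chi: "chi r v \<noteq> 0 \<Longrightarrow> inj_on (\<lambda>i. v i mod r) {..<r}"
  by (rule inj_onI, rule ccontr) (use chi_zero[of _ r _ v] in auto)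

lemma prod_sign_if:
  "finite A \<Longrightarrow> (\<Prod>x\<in>A. if P x then - 1 else (1::'a::comm_ring_1)) = (- 1) ^ card {x\<in>A. P x}"
  by (simp add: prod.If_cases Int_def)

lemma shat_tuple_eq_chi:
  "shat_tuple w = chi (length w) (\<lambda>i. w ! i + i)"
proof -
  define r where "r = length w"
  define v where "v = (\<lambda>i. w ! i + i)"
  have "shat_tuple w = (if inj_on (\<lambda>i. v i mod r) {..<r}
     then (-1) ^ card {(i, j). i < j \<and> j < r \<and> v i mod r > v j mod r} else 0)"
    by (simp add: shat_tuple_def r_def v_def Let_def)
  also have "\<dots> = chi r v"
  proof (cases "inj_on (\<lambda>i. v i mod r) {..<r}")
    case True
    have ne: "v i mod r \<noteq> v j mod r" if "i < j" "j < r" for i j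
      using inj_onD[OF True, of i j] that by auto
    have "chi r v = (\<Prod>x\<in>{(i, j). i < j \<and> j < r}. if v (fst x) mod r > v (snd x) mod r then - 1 else 1)"
      unfolding chi_def by (rule prod.cong) (use ne in \<open>fastforce+\<close>)
    also have "\<dots> = (-1) ^ card {(i, j). i < j \<and> j < r \<and> v i mod r > v j mod r}"
      by (subst prod_sign_if[OF finite_pairs]) (auto intro!: arg_cong[where f = "\<lambda>A. (-1) ^ card A"])
    finally show ?thesis using True by simp
  next
    case False
    then show ?thesis using inj_on_of_chi[of r v] by auto
  qed
  finally show ?thesis by (simp add: r_def v_def)
qed

text \<open>Exchanging positions \<open>a < b\<close> reverses the pair \<open>(a, b)\<close> and
  two more pairs for every position strictly between them, an odd number in total.\<close>

lemma chi_swap: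
  assumes "a < b" "b < r"
  shows "chi r (v \<circ> id(a := b, b := a)) = - chi r v"
proof -
  define t where "t = id(a := b, b := a)"
  have tt: "t (t x) = x" for x by (auto simp: t_def)
  have tr: "t x < r \<longleftrightarrow> x < r" for x using assms by (auto simp: t_def)
  have tinj: "t x = t y \<longleftrightarrow> x = y" for x y by (metis tt)
  let ?P = "{(i, j). i < j \<and> j < r}"
  define s where "s = (\<lambda>i j. sgn (int (v j mod r) - int (v i mod r)))"
  have s: "s i j = - s j i" for i j
    by (simp add: s_def sgn_if)
  \<comment> \<open>The image of a pair under the transposition, put back into increasing order. It
    is an involution on the index pairs, and reordering costs a sign exactly at the inversions of
    \<open>t\<close>.\<close>
  define \<phi> where "\<phi> = (\<lambda>(i, j). (min (t i) (t j), max (t i) (t j)))"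
  have bij: "bij_betw \<phi> ?P ?P"
  proof -
    have *: "\<phi> (\<phi> x) = x" "\<phi> x \<in> ?P" if xP: "x \<in> ?P" for x
    proof -
      obtain i j where x: "x = (i, j)" "i < j" "j < r" using xP by auto
      then show "\<phi> (\<phi> x) = x"
        using tinj[of i j] by (cases "t i < t j") (simp_all add: \<phi>_def min_def max_def tt)
      show "\<phi> x \<in> ?P"
        using x tinj[of i j] tr[of i] tr[of j] by (cases "t i < t j") (auto simp: \<phi>_def min_def max_def)
    qed
    show ?thesis
    proof (rule bij_betw_byWitness[where f' = \<phi>])
      show "\<phi> ` ?P \<subseteq> ?P" using *(2) by (rule image_subsetI)
      then show "\<phi> ` ?P \<subseteq> ?P" .
    qed (rule ballI, rule *(1), assumption)+
  qed
  have inv: "{x\<in>?P. t (fst x) > t (snd x)} = {(a, b)} \<union> ({a} \<times> {a<..<b}) \<union> ({a<..<b} \<times> {b})"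
  proof (rule set_eqI)
    fix x :: "nat \<times> nat"
    obtain i j where x: "x = (i, j)" by (cases x)
    have "i < j \<and> j < r \<and> t i > t j \<longleftrightarrow>
        i = a \<and> j = b \<or> i = a \<and> a < j \<and> j < b \<or> a < i \<and> i < b \<and> j = b"
    proof -
      have t: "t a = b" "t b = a" "\<And>x. x \<noteq> a \<Longrightarrow> x \<noteq> b \<Longrightarrow> t x = x"
        using assms by (auto simp: t_def)
      consider "i = a" | "i = b" | "i \<noteq> a" "i \<noteq> b" by blast
      then show ?thesis
      proof cases
        case 1
        then show ?thesis using assms t(1,2) t(3)[of j] by (cases "j = b") auto
      next
        case 2
        then show ?thesis using assms t(1,2) t(3)[of j] by (cases "j = a"; cases "j = b") auto
      next
        case 3
        then show ?thesis using assms t(1,2) t(3)[of i] t(3)[of j] by (cases "j = a"; cases "j = b") auto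
      qed
    qed
    then show "x \<in> {x\<in>?P. t (fst x) > t (snd x)} \<longleftrightarrow> x \<in> {(a, b)} \<union> ({a} \<times> {a<..<b}) \<union> ({a<..<b} \<times> {b})"
      by (auto simp: x)
  qed
  have "card {x\<in>?P. t (fst x) > t (snd x)} = 1 + card {a<..<b} + card {a<..<b}"
    unfolding inv by (subst card_Un_disjoint; (subst card_Un_disjoint)?) (auto simp: card_cartesian_product)
  then have odd: "odd (card {x\<in>?P. t (fst x) > t (snd x)})"
    by simp
  have "chi r (v \<circ> t) = (\<Prod>x\<in>?P. s (t (fst x)) (t (snd x)))"
    by (simp add: chi_def s_def case_prod_beta)
  also have "\<dots> = (\<Prod>x\<in>?P. (if t (fst x) > t (snd x) then - 1 else 1) * (case \<phi> x of (i, j) \<Rightarrow> s i j))"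
    by (rule prod.cong) (auto simp: \<phi>_def min_def max_def intro: s)
  also have "\<dots> = (- 1) ^ card {x\<in>?P. t (fst x) > t (snd x)} * (\<Prod>x\<in>?P. case \<phi> x of (i, j) \<Rightarrow> s i j)"
    unfolding prod.distrib by (subst prod_sign_if[OF finite_pairs]) simp
  also have "(\<Prod>x\<in>?P. case \<phi> x of (i, j) \<Rightarrow> s i j) = (\<Prod>(i, j)\<in>?P. s i j)"
    by (rule prod.reindex_bij_betw[OF bij])
  also have "\<dots> = chi r v" by (simp add: chi_def s_def)
  finally have "chi r (v \<circ> t) = - chi r v" using odd by (simp add: o_def)
  then show ?thesis unfolding t_def .
qed

text \<open>Distinct residues exhaust \<open>0, ..., r - 1\<close>. Adding 1 preserves their order
  except at the index with residue \<open>r - 1\<close>, which drops to 0 and so changes its order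
  relative to each of the \<open>r - 1\<close> others. A repeated residue stays repeated.\<close>

lemma chi_Suc:
  assumes "r > 0"
  shows "chi r (\<lambda>i. v i + 1) = (- 1) ^ (r - 1) * chi r v"
proof (cases "inj_on (\<lambda>i. v i mod r) {..<r}")
  case False
  then obtain i j where "i < r" "j < r" "i \<noteq> j" "v i mod r = v j mod r"
    by (auto simp: inj_on_def)
  moreover from this have "(v i + 1) mod r = (v j + 1) mod r"
    by (metis mod_add_left_eq)
  ultimately show ?thesis
    using chi_zero[of i r j v] chi_zero[of i r j "\<lambda>i. v i + 1"] by auto
next
  case True
  have "(\<lambda>i. v i mod r) ` {..<r} = {..<r}"
    using assms True by (intro card_subset_eq) (auto simp: card_image)
  then obtain k where k: "k < r" "v k mod r = r - 1"
    using assms by (metis (no_types, lifting) diff_less imageE lessThan_iff zero_less_one)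
  have other: "v i mod r < r - 1" if "i < r" "i \<noteq> k" for i
  proof -
    have "v i mod r \<noteq> r - 1"
      using inj_onD[OF True, of i k] k that by auto
    moreover have "v i mod r < r" using assms by simp
    ultimately show ?thesis by linarith
  qed
  have m1: "(v i + 1) mod r = v i mod r + 1" if "i < r" "i \<noteq> k" for i
    using other[OF that] by (metis Suc_eq_plus1 less_diff_conv mod_Suc nat_neq_iff)
  have m2: "(v k + 1) mod r = 0"
    using k assms by (metis Suc_eq_plus1 Suc_pred' mod_Suc)
  let ?P = "{(i, j). i < j \<and> j < r}"
  have "chi r (\<lambda>i. v i + 1) = (\<Prod>x\<in>?P. (if fst x = k \<or> snd x = k then - 1 else 1) *
     (case x of (i, j) \<Rightarrow> sgn (int (v j mod r) - int (v i mod r))))"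
    unfolding chi_def
  proof (rule prod.cong)
    fix x assume "x \<in> ?P"
    then obtain i j where x: "x = (i, j)" "i < j" "j < r" by auto
    have "sgn (int ((v j + 1) mod r) - int ((v i + 1) mod r)) =
      (if i = k \<or> j = k then - 1 else 1) * sgn (int (v j mod r) - int (v i mod r))"
    proof (cases "i = k")
      case True
      have "v j mod r < r - 1" using x True other[of j] by auto
      then show ?thesis
        using True x m1[of j] m2 k by (auto simp: sgn_if)
    next
      case False
      show ?thesis
      proof (cases "j = k")
        case True
        have "v i mod r < r - 1" using x False other[of i] by auto
        then show ?thesis
          using True False x m1[of i] m2 k by (auto simp: sgn_if)
      next
        case j: False
        show ?thesis using False j m1[of i] m1[of j] x by simp
      qed
    qed
    then show "(case x of (i, j) \<Rightarrow> sgn (int ((v j + 1) mod r) - int ((v i + 1) mod r))) =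
      (if fst x = k \<or> snd x = k then - 1 else 1) *
      (case x of (i, j) \<Rightarrow> sgn (int (v j mod r) - int (v i mod r)))"
      by (simp add: x)
  qed simp
  also have "\<dots> = (- 1) ^ card {x\<in>?P. fst x = k \<or> snd x = k} * chi r v"
    unfolding prod.distrib by (subst prod_sign_if[OF finite_pairs]) (simp add: chi_def)
  also have "{x\<in>?P. fst x = k \<or> snd x = k} = (\<lambda>i. if i < k then (i, k) else (k, i)) ` ({..<r} - {k})"
    using k by (force simp: image_iff split: if_splits)
  also have "card \<dots> = r - 1"
    using k by (subst card_image) (auto simp: inj_on_def split: if_splits)
  finally show ?thesis .
qed

text \<open>Distinct residues fill the whole cycle modulo \<open>r\<close>. Were the residues of
  \<open>A\<close> closed under successor, walking round the cycle from one of them would reach all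
  of them, and \<open>A\<close> would not be proper.\<close>

lemma exists_successor_outside:
  fixes r :: nat
  assumes "r > 0" "inj_on (\<lambda>i. v i mod r) {..<r}" "A \<subseteq> {..<r}" "A \<noteq> {}" "A \<noteq> {..<r}"
  obtains i j where "i \<in> A" "j < r" "j \<notin> A" "(v i + 1) mod r = v j mod r"
proof (rule ccontr)
  assume "\<not> thesis"
  note outside = that and * = this
  have surj: "(\<lambda>i. v i mod r) ` {..<r} = {..<r}"
    using assms(1,2) by (intro card_subset_eq) (auto simp: card_image)
  define R where "R = (\<lambda>i. v i mod r) ` A"
  have step: "(x + 1) mod r \<in> R" if xR: "x \<in> R" for x
  proof -
    obtain i where i: "i \<in> A" "x = v i mod r" using xR by (auto simp: R_def)
    have "(v i + 1) mod r \<in> (\<lambda>i. v i mod r) ` {..<r}"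
      using surj assms(1) by simp
    then obtain j where j: "j < r" "(v i + 1) mod r = v j mod r" by auto
    then have "j \<in> A" using * outside[of i j] i by blast
    then show ?thesis using j i by (auto simp: R_def mod_simps)
  qed
  obtain x0 where x0: "x0 \<in> R" using assms(4) by (auto simp: R_def)
  have steps: "(x0 + k) mod r \<in> R" for k
  proof (induction k)
    case 0
    then show ?case using x0 by (auto simp: R_def)
  next
    case (Suc k)
    then show ?case using step[OF Suc] by (simp add: mod_simps)
  qed
  have "y \<in> R" if y: "y < r" for y
  proof -
    have "x0 < r" using x0 assms(1) by (auto simp: R_def)
    \<comment> \<open>\<open>r - x0 + y\<close> steps lead from \<open>x0\<close> through the
      wrap-around at \<open>r\<close> to \<open>y\<close>.\<close>
    then have "(x0 + (r - x0 + y)) mod r = y" using y by simp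
    then show ?thesis using steps by metis
  qed
  then have "{..<r} \<subseteq> R" by auto
  then have "r \<le> card A"
    unfolding R_def using assms(3)
    by (metis card_image_le card_lessThan card_mono finite_imageI finite_lessThan finite_subset le_trans)
  then show False
    using assms(3,5) by (metis card_lessThan card_seteq finite_lessThan)
qed

text \<open>The \<open>k\<close>-th elementary polynomial in the unit shifts annihilates
  \<open>chi\<close>. If the residues are distinct, each term vanishes alone: some shifted index
  collides with an unshifted one. If indices \<open>a\<close> and \<open>b\<close> share a residue,
  exchanging them permutes the subsets and negates the terms, so the sum is its own
  negative.\<close>

lemma sum_chi_subsets:
  assumes "0 < k" "k < r"
  shows "(\<Sum>A | A \<subseteq> {..<r} \<and> card A = k. chi r (\<lambda>i. v i + of_bool (i \<in> A))) = 0"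
proof (cases "inj_on (\<lambda>i. v i mod r) {..<r}")
  case True
  show ?thesis
  proof (intro sum.neutral ballI)
    fix A assume A: "A \<in> {A. A \<subseteq> {..<r} \<and> card A = k}"
    then have "A \<noteq> {}" "A \<noteq> {..<r}" using assms by auto
    then obtain i j where ij: "i \<in> A" "j < r" "j \<notin> A" "(v i + 1) mod r = v j mod r"
      using exists_successor_outside[of r v A] True A assms by auto
    then show "chi r (\<lambda>i. v i + of_bool (i \<in> A)) = 0"
      using A by (intro chi_zero[of i r j]) auto
  qed
next
  case False
  then obtain a b where ab: "a < b" "b < r" "v a mod r = v b mod r"
    unfolding inj_on_def by (metis lessThan_iff linorder_neqE_nat)
  define t where "t = id(a := b, b := a)"
  have tt: "t (t x) = x" for x by (auto simp: t_def)
  have tim: "x \<in> t ` A \<longleftrightarrow> t x \<in> A" for x A by (metis imageE image_eqI tt)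
  let ?S = "{A. A \<subseteq> {..<r} \<and> card A = k}"
  let ?f = "\<lambda>A. chi r (\<lambda>i. v i + of_bool (i \<in> A))"
  have inj: "inj_on t A" for A by (metis inj_onI tt)
  have "bij_betw (\<lambda>A. t ` A) ?S ?S"
  proof (rule bij_betw_byWitness[where f' = "\<lambda>A. t ` A"])
    show "(\<lambda>A. t ` A) ` ?S \<subseteq> ?S"
      using ab card_image[OF inj] by (auto simp: t_def)
    then show "(\<lambda>A. t ` A) ` ?S \<subseteq> ?S" .
  qed (auto simp: image_image tt)
  then have "(\<Sum>A\<in>?S. ?f A) = (\<Sum>A\<in>?S. ?f (t ` A))"
    using sum.reindex_bij_betw[of "\<lambda>A. t ` A" ?S ?S ?f] by simp
  also have "\<dots> = (\<Sum>A\<in>?S. - ?f A)"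
  proof (rule sum.cong)
    fix A
    have "?f (t ` A) = chi r ((\<lambda>i. v i + of_bool (i \<in> A)) \<circ> t)"
    proof (rule chi_cong)
      fix i
      have "v (t i) mod r = v i mod r"
        using ab by (auto simp: t_def)
      then show "(v i + of_bool (i \<in> t ` A)) mod r = ((\<lambda>i. v i + of_bool (i \<in> A)) \<circ> t) i mod r"
        unfolding o_def tim by (metis mod_add_left_eq)
    qed
    then show "?f (t ` A) = - ?f A"
      using chi_swap[OF ab(1,2)] by (simp add: t_def)
  qed simp
  finally show ?thesis by (simp add: sum_negf)
qed

lemma sum_alternating_Pow:
  assumes "finite K"
  shows "(\<Sum>A\<in>Pow K. (- 1) ^ card A) = (if K = {} then 1 else 0 :: 'a::comm_ring_1)"
proof -
  have "(\<Sum>A\<in>Pow K. (- 1) ^ card A) = (\<Prod>x\<in>K. (- 1) + (1 :: 'a))"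
    unfolding prod_add[OF assms] by simp
  then show ?thesis using assms by (simp add: power_0_left)
qed

text \<open>
  Writing \<open>e\<^sub>k\<close> and \<open>h\<^sub>k\<close> for the elementary and complete symmetric polynomials in the \<open>r\<close> unit
  shifts of the argument of \<^const>\<open>chi\<close>, the operator identity \<open>\<Sum>\<^sub>k (-1)\<^sup>k e\<^sub>k h\<^sub>c\<^sub>-\<^sub>k = 0\<close> leaves only
  \<open>k = 0\<close> and \<open>k = r\<close>, since \<open>e\<^sub>k chi = 0\<close> for \<open>0 < k < r\<close>.
\<close>

lemma sum_chi_splits_rec:
  assumes "r > 0" "c > 0"
  shows "(\<Sum>a\<in>splits {..<r} c. chi r (\<lambda>i. v i + a i)) =
    (if r \<le> c then \<Sum>a\<in>splits {..<r} (c - r). chi r (\<lambda>i. v i + a i) else 0)"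
proof -
  let ?G = "\<lambda>c. \<Sum>a\<in>splits {..<r} c. chi r (\<lambda>i. v i + a i)"
  let ?P = "{A. A \<subseteq> {..<r} \<and> card A \<le> c}"
  let ?f = "\<lambda>A a. (- 1) ^ card A * chi r (\<lambda>i. v i + a i + of_bool (i \<in> A))"
  have finP: "finite ?P" by (rule finite_subset[of _ "Pow {..<r}"]) auto
  have card_supp: "card {i\<in>{..<r}. b i > 0} \<le> sum b {..<r}" for b :: "nat \<Rightarrow> nat"
  proof -
    have "card {i\<in>{..<r}. b i > 0} = (\<Sum>i\<in>{..<r}. of_bool (b i > 0))"
      by (simp add: Int_def)
    also have "\<dots> \<le> sum b {..<r}"
      by (rule sum_mono) auto
    finally show ?thesis .
  qed
  have sum_ind: "(\<Sum>i<r. of_bool (i \<in> A)) = card A" if "A \<subseteq> {..<r}" for A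
    using that by (simp add: Int_absorb1)
  \<comment> \<open>The signed subsets \<open>A\<close> of the support of \<open>b\<close> cancel
    because \<open>b\<close> is not zero. Writing \<open>b\<close> as \<open>a\<close> plus the
    indicator of \<open>A\<close> turns this zero into the alternating sum of products of an
    elementary and a complete polynomial in the shifts.\<close>
  have "0 = (\<Sum>b\<in>splits {..<r} c. \<Sum>A\<in>Pow {i\<in>{..<r}. b i > 0}. (- 1) ^ card A * chi r (\<lambda>i. v i + b i))"
  proof (rule sum.neutral[symmetric], rule ballI)
    fix b :: "nat \<Rightarrow> nat" assume "b \<in> splits {..<r} c"
    then have "sum b {..<r} \<noteq> 0"
      using assms by (simp add: splits_def)
    then have "\<not> (\<forall>i\<in>{..<r}. b i = 0)"
      by (metis sum.neutral)
    then have "{i\<in>{..<r}. b i > 0} \<noteq> {}"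
      by auto
    then show "(\<Sum>A\<in>Pow {i\<in>{..<r}. b i > 0}. (- 1) ^ card A * chi r (\<lambda>i. v i + b i)) = 0"
      by (subst sum_distrib_right[symmetric], subst sum_alternating_Pow) auto
  qed
  also have "\<dots> = (\<Sum>(b, A)\<in>(SIGMA b:splits {..<r} c. Pow {i\<in>{..<r}. b i > 0}).
      (- 1) ^ card A * chi r (\<lambda>i. v i + b i))"
    by (rule sum.Sigma) (auto simp: finite_nat_splits)
  also have "\<dots> = (\<Sum>(A, a)\<in>(SIGMA A:?P. splits {..<r} (c - card A)). ?f A a)"
  proof (rule sum.reindex_bij_witness
      [where i = "\<lambda>(A, a). (\<lambda>i. a i + of_bool (i \<in> A), A)" and j = "\<lambda>(b, A). (A, \<lambda>i. b i - of_bool (i \<in> A))"], goal_cases)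
    case (1 x)
    then show ?case by (force simp: fun_eq_iff)
  next
    case (2 x)
    then obtain b A where x: "x = (b, A)" "b \<in> splits {..<r} c" "A \<subseteq> {i\<in>{..<r}. b i > 0}" by auto
    then have "card A \<le> card {i\<in>{..<r}. b i > 0}"
      by (intro card_mono) auto
    then have cA: "card A \<le> c" using card_supp[of b] x by (auto simp: splits_def)
    have "(\<Sum>i<r. b i - of_bool (i \<in> A)) = (\<Sum>i<r. b i) - (\<Sum>i<r. of_bool (i \<in> A))"
      using x by (intro sum_subtractf_nat) auto
    then show ?case
      using x cA sum_ind[of A] by (force simp: splits_def)
  next
    case (3 x)
    then show ?case by (auto simp: fun_eq_iff)
  next
    case (4 x)
    then obtain A a where x: "x = (A, a)" "A \<subseteq> {..<r}" "card A \<le> c" "a \<in> splits {..<r} (c - card A)" by auto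
    then show ?case using sum_ind[of A] by (auto simp: splits_def sum.distrib)
  next
    case (5 x)
    then obtain b A where x: "x = (b, A)" "b \<in> splits {..<r} c" "A \<subseteq> {i\<in>{..<r}. b i > 0}" by auto
    then have "(\<lambda>i. v i + (b i - of_bool (i \<in> A)) + of_bool (i \<in> A)) = (\<lambda>i. v i + b i)"
      by (force simp: fun_eq_iff)
    then show ?case using x by simp
  qed
  also have "\<dots> = (\<Sum>A\<in>?P. \<Sum>a\<in>splits {..<r} (c - card A). ?f A a)"
    by (rule sum.Sigma[symmetric]) (auto simp: finite_nat_splits finP)
  also have "\<dots> = (\<Sum>k\<in>{..min r c}. \<Sum>A\<in>{A\<in>?P. card A = k}. \<Sum>a\<in>splits {..<r} (c - card A). ?f A a)"
    by (rule sum.group[symmetric, OF finP]) (use card_mono[of "{..<r}"] in fastforce)+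
  \<comment> \<open>For \<open>k = r\<close> the only subset is the full one; its sign
    \<open>(-1)^r\<close> meets \<open>(-1)^(r-1)\<close> from \<open>chi_Suc\<close>, which leaves
    -1.\<close>
  also have "\<dots> = (\<Sum>k\<in>{..min r c}. if k = 0 then ?G c else if k = r then - ?G (c - r) else 0)"
  proof (rule sum.cong)
    fix k assume k: "k \<in> {..min r c}"
    have "(\<Sum>A\<in>{A\<in>?P. card A = k}. \<Sum>a\<in>splits {..<r} (c - card A). ?f A a) =
      (\<Sum>A\<in>{A. A \<subseteq> {..<r} \<and> card A = k}. \<Sum>a\<in>splits {..<r} (c - k). ?f A a)"
      using k by (intro sum.cong) auto
    also have "\<dots> = (\<Sum>a\<in>splits {..<r} (c - k). \<Sum>A | A \<subseteq> {..<r} \<and> card A = k. ?f A a)"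
      by (rule sum.swap)
    also have "\<dots> = (\<Sum>a\<in>splits {..<r} (c - k). (- 1) ^ k *
        (\<Sum>A | A \<subseteq> {..<r} \<and> card A = k. chi r (\<lambda>i. v i + a i + of_bool (i \<in> A))))"
      unfolding sum_distrib_left by (intro sum.cong) auto
    also have "\<dots> = (if k = 0 then ?G c else if k = r then - ?G (c - r) else 0)"
    proof -
      consider "k = 0" | "k = r" "k > 0" | "0 < k" "k < r" using k by fastforce
      then show ?thesis
      proof cases
        case 1
        then have "{A. A \<subseteq> {..<r} \<and> card A = k} = {{}}"
          by (auto dest: finite_subset)
        then show ?thesis using 1 by simp
      next
        case 2
        have "{A. A \<subseteq> {..<r} \<and> card A = k} = {{..<r}}"
          using 2 by (auto dest: card_subset_eq[rotated])
        moreover have "chi r (\<lambda>i. v i + a i + of_bool (i \<in> {..<r})) = (- 1) ^ (r - 1) * chi r (\<lambda>i. v i + a i)" for a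
          unfolding chi_Suc[OF assms(1), symmetric] by (rule chi_cong) simp
        moreover have "(- 1) ^ r * ((- 1) ^ (r - 1) * x) = - x" for x :: int
          using assms(1) by (cases r) auto
        ultimately show ?thesis using 2 by (simp add: sum_negf)
      next
        case 3
        then show ?thesis by (simp add: sum_chi_subsets)
      qed
    qed
    finally show "(\<Sum>A\<in>{A\<in>?P. card A = k}. \<Sum>a\<in>splits {..<r} (c - card A). ?f A a) =
      (if k = 0 then ?G c else if k = r then - ?G (c - r) else 0)" .
  qed simp
  also have "\<dots> = (\<Sum>k\<in>{..min r c}. (if k = 0 then ?G c else 0) + (if k = r then - ?G (c - r) else 0))"
    using assms by (intro sum.cong) auto
  also have "\<dots> = ?G c - (if r \<le> c then ?G (c - r) else 0)"
    unfolding sum.distrib by (subst (1 2) sum.delta) auto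
  finally show ?thesis by simp
qed

text \<open>The recursion lowers \<open>c\<close> by \<open>r\<close>. It ends at
  \<open>c = 0\<close> if \<open>r\<close> divides \<open>c\<close>, and otherwise at some
  \<open>0 < c < r\<close>, where the sum is 0.\<close>

lemma sum_chi_splits_nat:
  assumes "r > 0"
  shows "(\<Sum>a\<in>splits {..<r} c. chi r (\<lambda>i. v i + a i)) = (if r dvd c then chi r v else 0)"
proof (induction c rule: less_induct)
  case (less c)
  show ?case
  proof (cases "c = 0")
    case True
    have "splits {..<r} (0::nat) = {\<lambda>_. 0}" by (auto simp: splits_def fun_eq_iff)
    then show ?thesis using True by simp
  next
    case False
    then show ?thesis
      using assms less[of "c - r"]
      by (auto simp: sum_chi_splits_rec dvd_imp_le dvd_minus_self)
  qed
qed

text \<open>One notion for both degrees in use: weight \<open>fst\<close> gives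
  \<open>pdegree\<close>, and constant weight 1 counts variables with multiplicity.\<close>

definition wdeg :: "('v \<Rightarrow> nat) \<Rightarrow> ('v \<Rightarrow>\<^sub>0 nat) \<Rightarrow> nat"
  where "wdeg f m = (\<Sum>v\<in>Poly_Mapping.keys m. f v * Poly_Mapping.lookup m v)"

abbreviation mdeg :: "('v \<Rightarrow>\<^sub>0 nat) \<Rightarrow> nat"
  where "mdeg \<equiv> wdeg (\<lambda>_. Suc 0)"

lemma pdegree_eq_wdeg: "pdegree = wdeg fst"
  by (simp add: pdegree_def wdeg_def fun_eq_iff)

lemma wdeg_superset:
  "finite K \<Longrightarrow> Poly_Mapping.keys m \<subseteq> K \<Longrightarrow> wdeg f m = (\<Sum>v\<in>K. f v * Poly_Mapping.lookup m v)"
  unfolding wdeg_def by (intro sum.mono_neutral_left) (auto simp: in_keys_iff)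

lemma wdeg_0 [simp]: "wdeg f 0 = 0"
  by (simp add: wdeg_def)

lemma keys_plus_nat:
  fixes m m' :: "'v \<Rightarrow>\<^sub>0 nat"
  shows "Poly_Mapping.keys (m + m') = Poly_Mapping.keys m \<union> Poly_Mapping.keys m'"
  by (auto simp: in_keys_iff lookup_add)

lemma wdeg_add: "wdeg f (m + m') = wdeg f m + wdeg f m'"
proof -
  let ?K = "Poly_Mapping.keys m \<union> Poly_Mapping.keys m'"
  have "wdeg f (m + m') = (\<Sum>v\<in>?K. f v * Poly_Mapping.lookup (m + m') v)"
    by (rule wdeg_superset) (auto simp: keys_plus_nat)
  also have "\<dots> = (\<Sum>v\<in>?K. f v * Poly_Mapping.lookup m v) + (\<Sum>v\<in>?K. f v * Poly_Mapping.lookup m' v)"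
    by (simp add: lookup_add distrib_left sum.distrib)
  also have "\<dots> = wdeg f m + wdeg f m'"
    by (simp add: wdeg_superset[of ?K])
  finally show ?thesis .
qed

lemma wdeg_sum: "wdeg f (sum q I) = (\<Sum>i\<in>I. wdeg f (q i))"
  by (induction I rule: infinite_finite_induct) (auto simp: wdeg_add)

lemma wdeg_single [simp]: "wdeg f (Poly_Mapping.single x c) = f x * c"
  by (auto simp: wdeg_def)

lemma keys_sum_nat:
  fixes q :: "'i \<Rightarrow> 'v \<Rightarrow>\<^sub>0 nat"
  shows "finite I \<Longrightarrow> Poly_Mapping.keys (sum q I) = (\<Union>i\<in>I. Poly_Mapping.keys (q i))"
  by (induction I rule: finite_induct) (auto simp: keys_plus_nat)

text \<open>Induction over the variables of \<open>m\<close>. A splitting with one more variable is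
  a splitting of the old monomial together with a splitting of the new exponent \<open>c\<close>.
  Summing over the latter first, from the starting vector \<open>v i + mdeg (q i)\<close>, gives the
  scalar for \<open>c\<close>.\<close>

lemma sum_chi_splits_monomial:
  fixes m :: "'v \<Rightarrow>\<^sub>0 nat"
  assumes "r > 0"
  shows "(\<Sum>q\<in>splits {..<r} m. chi r (\<lambda>i. v i + mdeg (q i))) =
    (if \<forall>x. r dvd Poly_Mapping.lookup m x then chi r v else 0)"
proof (induction m rule: update_induct)
  case const
  have "splits {..<r} (0 :: 'v \<Rightarrow>\<^sub>0 nat) = {\<lambda>_. 0}"
  proof -
    have "q i = 0" if "\<forall>i. i \<notin> {..<r} \<longrightarrow> q i = 0" "sum q {..<r} = 0" for q :: "nat \<Rightarrow> 'v \<Rightarrow>\<^sub>0 nat" and i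
      using that keys_sum_nat[of "{..<r}" q] by (cases "i < r") auto
    then show ?thesis by (auto simp: splits_def fun_eq_iff)
  qed
  then show ?case by simp
next
  case (update m x c)
  let ?s = "Poly_Mapping.single x"
  let ?m = "Poly_Mapping.update x c m"
  have m0: "Poly_Mapping.lookup m x = 0" using update by (simp add: in_keys_iff)
  have lk: "Poly_Mapping.lookup ?m y = (if y = x then c else Poly_Mapping.lookup m y)" for y
    by (simp add: lookup_update)
  have "(\<Sum>q\<in>splits {..<r} ?m. chi r (\<lambda>i. v i + mdeg (q i))) =
    (\<Sum>(q, a)\<in>splits {..<r} m \<times> splits {..<r} c. chi r (\<lambda>i. v i + mdeg (q i) + a i))"
  proof (rule sum.reindex_bij_witness
      [where i = "\<lambda>(q, a). \<lambda>i. q i + ?s (a i)" and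
        j = "\<lambda>q. (\<lambda>i. Poly_Mapping.update x 0 (q i), \<lambda>i. Poly_Mapping.lookup (q i) x)"], goal_cases)
    case (1 q)
    show ?case
      by (auto simp: fun_eq_iff intro!: poly_mapping_eqI simp: lookup_add lookup_update lookup_single when_def)
  next
    case (2 q)
    then have q: "\<And>i. i \<notin> {..<r} \<Longrightarrow> q i = 0" "sum q {..<r} = ?m" by (auto simp: splits_def)
    have "(\<Sum>i<r. Poly_Mapping.lookup (q i) y) = Poly_Mapping.lookup ?m y" for y
      unfolding q(2)[symmetric] lookup_sum ..
    then have lq: "(\<Sum>i<r. Poly_Mapping.lookup (q i) y) = (if y = x then c else Poly_Mapping.lookup m y)" for y
      unfolding lk .
    have "(\<Sum>i<r. Poly_Mapping.update x 0 (q i)) = m"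
    proof (rule poly_mapping_eqI)
      fix y
      show "Poly_Mapping.lookup (\<Sum>i<r. Poly_Mapping.update x 0 (q i)) y = Poly_Mapping.lookup m y"
        using lq[of y] m0 by (cases "y = x") (auto simp: lookup_sum lookup_update)
    qed
    moreover have "(\<Sum>i<r. Poly_Mapping.lookup (q i) x) = c"
      using lq[of x] by simp
    ultimately show ?case
      using q(1) by (auto simp: splits_def intro!: poly_mapping_eqI simp: lookup_update)
  next
    case (3 p)
    then obtain q a where p: "p = (q, a)" "\<And>i. i \<notin> {..<r} \<Longrightarrow> q i = 0" "sum q {..<r} = m" by (auto simp: splits_def)
    have "Poly_Mapping.lookup (q i) x = 0" for i
    proof (cases "i < r")
      case True
      have "(\<Sum>i<r. Poly_Mapping.lookup (q i) x) = 0"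
        using p(3) m0 by (metis lookup_sum)
      then show ?thesis using True by simp
    qed (use p(2) in auto)
    then show ?case
      by (auto simp: p(1) fun_eq_iff lookup_add lookup_update lookup_single when_def intro!: poly_mapping_eqI)
  next
    case (4 p)
    then obtain q a where p: "p = (q, a)" "q \<in> splits {..<r} m" "a \<in> splits {..<r} c" by auto
    have "(\<Sum>i<r. ?s (a i)) = ?s (sum a {..<r})"
      by (auto intro!: poly_mapping_eqI simp: lookup_sum lookup_single when_def)
    then have "(\<Sum>i<r. q i + ?s (a i)) = m + ?s c"
      using p by (simp add: sum.distrib splits_def)
    also have "\<dots> = ?m"
      using m0 by (auto intro!: poly_mapping_eqI simp: lookup_add lookup_update lookup_single when_def)
    finally show ?case using p by (auto simp: splits_def)
  next
    case (5 q)
    have "mdeg (q i) = mdeg (Poly_Mapping.update x 0 (q i)) + Poly_Mapping.lookup (q i) x" for i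
    proof -
      have "q i = Poly_Mapping.update x 0 (q i) + ?s (Poly_Mapping.lookup (q i) x)"
        by (auto intro!: poly_mapping_eqI simp: lookup_add lookup_update lookup_single when_def)
      then have "mdeg (q i) = mdeg (Poly_Mapping.update x 0 (q i) + ?s (Poly_Mapping.lookup (q i) x))"
        by simp
      then show ?thesis by (simp only: wdeg_add wdeg_single One_nat_def[symmetric] mult_1)
    qed
    then show ?case by (simp add: add.assoc)
  qed
  also have "\<dots> = (\<Sum>q\<in>splits {..<r} m. if r dvd c then chi r (\<lambda>i. v i + mdeg (q i)) else 0)"
    by (simp add: sum.cartesian_product[symmetric] sum_chi_splits_nat[OF assms])
  also have "\<dots> = (if \<forall>y. r dvd Poly_Mapping.lookup ?m y then chi r v else 0)"
  proof -
    have iff: "(\<forall>y. r dvd Poly_Mapping.lookup ?m y) \<longleftrightarrow> r dvd c \<and> (\<forall>y. r dvd Poly_Mapping.lookup m y)"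
      using m0 unfolding lk by (metis dvd_0_right)
    show ?thesis unfolding iff using update(3) by (cases "r dvd c") simp_all
  qed
  finally show ?case .
qed

section \<open>Elementary and complete symmetric functions\<close>

definition complete_sym :: "nat \<Rightarrow> nat \<Rightarrow> pseries"
  where "complete_sym i a = Abs_mfps (\<lambda>m. of_bool (Poly_Mapping.keys m \<subseteq> {i} \<times> {1..} \<and> mdeg m = a))"

lemma nth_complete_sym:
  "mfps_nth (complete_sym i a) m = of_bool (Poly_Mapping.keys m \<subseteq> {i} \<times> {1..} \<and> mdeg m = a)"
  by (simp add: complete_sym_def)

definition squarefree_monomial :: "('v \<Rightarrow>\<^sub>0 nat) \<Rightarrow> bool"
  where "squarefree_monomial m \<longleftrightarrow> (\<forall>v\<in>Poly_Mapping.keys m. Poly_Mapping.lookup m v = 1)"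

lemma nth_elem_sym:
  "mfps_nth (elem_sym i k) m =
    of_bool (Poly_Mapping.keys m \<subseteq> {i} \<times> {1..} \<and> squarefree_monomial m \<and> mdeg m = k)"
  by (auto simp: elem_sym_def squarefree_monomial_def wdeg_def)

definition set_monomial :: "'v set \<Rightarrow> 'v \<Rightarrow>\<^sub>0 nat"
  where "set_monomial A = (\<Sum>v\<in>A. Poly_Mapping.single v 1)"

lemma lookup_set_monomial:
  "finite A \<Longrightarrow> Poly_Mapping.lookup (set_monomial A) v = of_bool (v \<in> A)"
  by (simp add: set_monomial_def lookup_sum lookup_single when_def)

lemma keys_set_monomial: "finite A \<Longrightarrow> Poly_Mapping.keys (set_monomial A) = A"
  by (auto simp: in_keys_iff lookup_set_monomial)

lemma squarefree_set_monomial: "finite A \<Longrightarrow> squarefree_monomial (set_monomial A)"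
  by (auto simp: squarefree_monomial_def keys_set_monomial lookup_set_monomial)

lemma set_monomial_keys:
  "squarefree_monomial m \<Longrightarrow> set_monomial (Poly_Mapping.keys m) = m"
  by (rule poly_mapping_eqI) (auto simp: squarefree_monomial_def lookup_set_monomial in_keys_iff)

lemma mdeg_squarefree: "squarefree_monomial m \<Longrightarrow> mdeg m = card (Poly_Mapping.keys m)"
  by (simp add: squarefree_monomial_def wdeg_def)

text \<open>Squarefree divisors of \<open>m\<close> correspond to sets of variables of
  \<open>m\<close>, the cofactor being determined; the sum is the alternating sum over all
  subsets.\<close>

lemma sum_alternating_squarefree:
  fixes m :: "'v \<Rightarrow>\<^sub>0 nat"
  shows "(\<Sum>(p, q)\<in>{(p, q). p + q = m}. if squarefree_monomial p then (- 1) ^ mdeg p else 0) =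
    (if m = 0 then 1 else 0 :: 'a::comm_ring_1)"
proof -
  let ?S = "{x\<in>{(p, q). p + q = m}. squarefree_monomial (fst x)}"
  have "(\<Sum>(p, q)\<in>{(p, q). p + q = m}. if squarefree_monomial p then (- 1) ^ mdeg p else 0) =
      (\<Sum>x\<in>?S. (- 1 :: 'a) ^ mdeg (fst x))"
    unfolding sum.inter_filter[OF finite_monomial_summands] by (rule sum.cong) auto
  also have "\<dots> = (\<Sum>A\<in>Pow (Poly_Mapping.keys m). (- 1) ^ card A)"
  proof (rule sum.reindex_bij_witness
      [where i = "\<lambda>A. (set_monomial A, m - set_monomial A)" and j = "\<lambda>x. Poly_Mapping.keys (fst x)"], goal_cases)
    case (1 x)
    then show ?case by (auto simp: set_monomial_keys)
  next
    case (2 x)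
    then show ?case by (auto simp: keys_plus_nat)
  next
    case (3 A)
    then show ?case using keys_set_monomial[of A] finite_subset[of A] by auto
  next
    case (4 A)
    then have A: "A \<subseteq> Poly_Mapping.keys m" "finite A" using finite_subset[of A] by auto
    have "set_monomial A + (m - set_monomial A) = m"
    proof (rule poly_mapping_eqI)
      fix v
      have "v \<in> A \<Longrightarrow> Poly_Mapping.lookup m v > 0" using A by (auto simp: in_keys_iff)
      then show "Poly_Mapping.lookup (set_monomial A + (m - set_monomial A)) v = Poly_Mapping.lookup m v"
        using A by (auto simp: lookup_add lookup_minus lookup_set_monomial)
    qed
    then show ?case using A by (simp add: squarefree_set_monomial)
  next
    case (5 x)
    then show ?case by (auto simp: mdeg_squarefree)
  qed
  also have "\<dots> = (if m = 0 then 1 else 0)"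
    by (subst sum_alternating_Pow) auto
  finally show ?thesis .
qed

lemma mdeg_eq_0_iff: "mdeg m = 0 \<longleftrightarrow> m = 0"
  by (auto simp: wdeg_def in_keys_iff intro!: poly_mapping_eqI)

text \<open>At a factorisation \<open>m = p + q\<close> only \<open>k = mdeg p\<close> can
  contribute, which leaves the alternating sum over squarefree divisors of \<open>m\<close>.\<close>

lemma sum_elem_complete:
  "(\<Sum>k\<le>a. (- 1) ^ k * elem_sym i k * complete_sym i (a - k)) = (if a = 0 then 1 else 0)"
proof (rule mfps_eqI)
  fix m :: "nat \<times> nat \<Rightarrow>\<^sub>0 nat"
  let ?V = "{i} \<times> {1..} :: (nat \<times> nat) set"
  have "mfps_nth (\<Sum>k\<le>a. (- 1) ^ k * elem_sym i k * complete_sym i (a - k)) m =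
    (\<Sum>k\<le>a. (- 1) ^ k * (\<Sum>(p, q)\<in>{(p, q). p + q = m}. mfps_nth (elem_sym i k) p * mfps_nth (complete_sym i (a - k)) q))"
  proof -
    have *: "(- 1) ^ k * elem_sym i k * complete_sym i (a - k) =
        of_int ((- 1) ^ k) * (elem_sym i k * complete_sym i (a - k))" for k
      by (simp add: mult.assoc)
    then show ?thesis
      unfolding * nth_sum nth_of_int_times by (simp add: times_mfps.rep_eq)
  qed
  also have "\<dots> = (\<Sum>k\<le>a. \<Sum>(p, q)\<in>{(p, q). p + q = m}.
      (- 1) ^ k * (mfps_nth (elem_sym i k) p * mfps_nth (complete_sym i (a - k)) q))"
    by (simp add: sum_distrib_left case_prod_beta)
  also have "\<dots> = (\<Sum>(p, q)\<in>{(p, q). p + q = m}. \<Sum>k\<le>a.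
      (- 1) ^ k * (mfps_nth (elem_sym i k) p * mfps_nth (complete_sym i (a - k)) q))"
    by (subst sum.swap) (simp add: case_prod_beta)
  also have "\<dots> = (\<Sum>(p, q)\<in>{(p, q). p + q = m}.
      of_bool (Poly_Mapping.keys m \<subseteq> ?V \<and> mdeg m = a) * (if squarefree_monomial p then (- 1) ^ mdeg p else 0))"
  proof (rule sum.cong)
    fix x assume "x \<in> {(p, q). p + q = m}"
    then obtain p q where x: "x = (p, q)" "m = p + q" by auto
    have "(\<Sum>k\<le>a. (- 1) ^ k * (mfps_nth (elem_sym i k) p * mfps_nth (complete_sym i (a - k)) q)) =
      (\<Sum>k\<le>a. if k = mdeg p then (- 1) ^ k * of_bool (Poly_Mapping.keys p \<subseteq> ?V \<and> squarefree_monomial p \<and>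
        Poly_Mapping.keys q \<subseteq> ?V \<and> mdeg q = a - k) else (0::rat))"
      by (rule sum.cong) (auto simp: nth_elem_sym nth_complete_sym)
    also have "\<dots> = of_bool (Poly_Mapping.keys m \<subseteq> ?V \<and> mdeg m = a) * (if squarefree_monomial p then (- 1) ^ mdeg p else 0)"
      by (subst sum.delta) (auto simp: x keys_plus_nat wdeg_add)
    finally show "(case x of (p, q) \<Rightarrow> \<Sum>k\<le>a.
      (- 1) ^ k * (mfps_nth (elem_sym i k) p * mfps_nth (complete_sym i (a - k)) q)) =
      (case x of (p, q) \<Rightarrow> of_bool (Poly_Mapping.keys m \<subseteq> ?V \<and> mdeg m = a) * (if squarefree_monomial p then (- 1) ^ mdeg p else 0))"
      by (simp add: x)
  qed simp
  also have "\<dots> = of_bool (Poly_Mapping.keys m \<subseteq> ?V \<and> mdeg m = a) * (if m = 0 then 1 else 0)"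
    unfolding sum_alternating_squarefree[symmetric] sum_distrib_left by (simp add: case_prod_beta)
  also have "\<dots> = mfps_nth (if a = 0 then 1 else 0) m"
    by (auto simp: one_mfps.rep_eq zero_mfps.rep_eq)
  finally show "mfps_nth (\<Sum>k\<le>a. (- 1) ^ k * elem_sym i k * complete_sym i (a - k)) m =
    mfps_nth (if a = 0 then 1 else 0) m" .
qed

lemma elem_sym_0: "elem_sym i 0 = 1"
  by (rule mfps_eqI) (auto simp: nth_elem_sym one_mfps.rep_eq mdeg_eq_0_iff squarefree_monomial_def)

lemma complete_sym_0: "complete_sym i 0 = 1"
  by (rule mfps_eqI) (auto simp: nth_complete_sym one_mfps.rep_eq mdeg_eq_0_iff)

text \<open>Over a composition of \<open>a\<close> with \<open>l\<close> parts the signs multiply to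
  \<open>(-1)^(a - l)\<close>. It is applied to parts \<open>b \<ge> 1\<close> only, where
  \<open>b - 1\<close> is a true difference.\<close>

definition signed_elem :: "nat \<Rightarrow> nat \<Rightarrow> pseries"
  where "signed_elem i b = (- 1) ^ (b - 1) * elem_sym i b"

lemma complete_sym_rec:
  assumes "a > 0"
  shows "complete_sym i a = (\<Sum>k\<in>{1..a}. signed_elem i k * complete_sym i (a - k))"
proof -
  have "0 = (\<Sum>k\<le>a. (- 1) ^ k * elem_sym i k * complete_sym i (a - k))"
    using assms by (simp add: sum_elem_complete)
  also have "{..a} = insert 0 {1..a}"
    by auto
  also have "(\<Sum>k\<in>insert 0 {1..a}. (- 1) ^ k * elem_sym i k * complete_sym i (a - k)) =
      complete_sym i a + (\<Sum>k\<in>{1..a}. (- 1) ^ k * elem_sym i k * complete_sym i (a - k))"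
    by (subst sum.insert) (auto simp: elem_sym_0)
  also have "(\<Sum>k\<in>{1..a}. (- 1) ^ k * elem_sym i k * complete_sym i (a - k)) =
      (\<Sum>k\<in>{1..a}. - (signed_elem i k * complete_sym i (a - k)))"
  proof (rule sum.cong)
    fix k assume "k \<in> {1..a}"
    then obtain j where "k = Suc j" by (cases k) auto
    then show "(- 1) ^ k * elem_sym i k * complete_sym i (a - k) = - (signed_elem i k * complete_sym i (a - k))"
      by (simp add: signed_elem_def)
  qed simp
  finally show ?thesis by (simp add: sum_negf)
qed

section \<open>Compositions, and complete symmetric functions in terms of elementary ones\<close>

definition comps :: "nat \<Rightarrow> nat list set"
  where "comps a = {\<beta>. composition \<beta> \<and> sum_list \<beta> = a}"

lemma comps_0: "comps 0 = {[]}"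
proof -
  have "\<beta> = []" if "composition \<beta>" "sum_list \<beta> = 0" for \<beta>
    using that by (cases \<beta>) (auto simp: composition_def)
  then show ?thesis by (auto simp: comps_def composition_def)
qed

lemma comps_rec:
  assumes "a > 0"
  shows "bij_betw (\<lambda>(k, \<beta>). k # \<beta>) (SIGMA k:{1..a}. comps (a - k)) (comps a)"
proof (rule bij_betw_imageI)
  show "inj_on (\<lambda>(k, \<beta>). k # \<beta>) (SIGMA k:{1..a}. comps (a - k))"
    by (auto simp: inj_on_def)
  show "(\<lambda>(k, \<beta>). k # \<beta>) ` (SIGMA k:{1..a}. comps (a - k)) = comps a"
  proof (intro equalityI subsetI)
    fix \<beta> assume "\<beta> \<in> comps a"
    then show "\<beta> \<in> (\<lambda>(k, \<beta>). k # \<beta>) ` (SIGMA k:{1..a}. comps (a - k))"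
      using assms by (cases \<beta>) (auto simp: comps_def composition_def image_iff)
  qed (auto simp: comps_def composition_def)
qed

lemma finite_comps: "finite (comps a)"
proof (induction a rule: less_induct)
  case (less a)
  show ?case
  proof (cases "a = 0")
    case False
    have "finite (SIGMA k:{1..a}. comps (a - k))"
      using less False by (intro finite_SigmaI) auto
    then show ?thesis using comps_rec[of a] False bij_betw_finite by blast
  qed (simp add: comps_0)
qed

text \<open>Iterating the recursion \<open>complete_sym_rec\<close>: its summation index
  \<open>k\<close> is the first part of the composition.\<close>

lemma complete_sym_expand:
  "complete_sym i a = (\<Sum>\<beta>\<in>comps a. prod_list (map (signed_elem i) \<beta>))"
proof (induction a rule: less_induct)
  case (less a)
  show ?case
  proof (cases "a = 0")
    case False
    then have "(\<Sum>\<beta>\<in>comps a. prod_list (map (signed_elem i) \<beta>)) =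
      (\<Sum>(k, \<beta>)\<in>(SIGMA k:{1..a}. comps (a - k)). prod_list (map (signed_elem i) (k # \<beta>)))"
      using sum.reindex_bij_betw[OF comps_rec, of a "\<lambda>\<beta>. prod_list (map (signed_elem i) \<beta>)"]
      by (simp add: case_prod_beta)
    also have "\<dots> = (\<Sum>k\<in>{1..a}. \<Sum>\<beta>\<in>comps (a - k). prod_list (map (signed_elem i) (k # \<beta>)))"
      by (rule sum.Sigma[symmetric]) (auto simp: finite_comps)
    also have "\<dots> = (\<Sum>k\<in>{1..a}. signed_elem i k * complete_sym i (a - k))"
      by (rule sum.cong) (auto simp: less sum_distrib_left)
    finally show ?thesis
      using False complete_sym_rec[of a i] by simp
  qed (simp add: complete_sym_0 comps_0)
qed

lemma prod_of_bool: "finite I \<Longrightarrow> (\<Prod>i\<in>I. of_bool (P i)) = (of_bool (\<forall>i\<in>I. P i) :: 'a::comm_semiring_1)"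
  by (induction I rule: finite_induct) auto

text \<open>The plethysm $p_r[h_{N/r}]$ in the variables $x_{i1}, x_{i2}, \ldots$.\<close>

lemma nth_sum_shat_tuple:
  assumes "r > 0"
  shows "mfps_nth (\<Sum>w | length w = r \<and> sum_list w = N.
      of_int (shat_tuple w) * prod_list (map (complete_sym i) w)) m =
    of_bool (Poly_Mapping.keys m \<subseteq> {i} \<times> {1..} \<and> mdeg m = N \<and> (\<forall>v. r dvd Poly_Mapping.lookup m v))"
proof -
  let ?V = "{i} \<times> {1..} :: (nat \<times> nat) set"
  have list_sum: "sum_list (map a [0..<r]) = sum a {..<r}" for a :: "nat \<Rightarrow> nat"
    by (simp add: interv_sum_list_conv_sum_set_nat atLeast0LessThan)
  have list_prod: "prod_list (map f [0..<r]) = prod f {..<r}" for f :: "nat \<Rightarrow> pseries"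
    using prod.distinct_set_conv_list[of "[0..<r]" f] by (simp add: atLeast0LessThan)
  have "(\<Sum>w | length w = r \<and> sum_list w = N. of_int (shat_tuple w) * prod_list (map (complete_sym i) w)) =
    (\<Sum>a\<in>splits {..<r} N. of_int (chi r (\<lambda>j. j + a j)) * (\<Prod>j<r. complete_sym i (a j)))"
  proof (rule sum.reindex_bij_witness
      [where i = "\<lambda>a. map a [0..<r]" and j = "\<lambda>w j. if j < r then w ! j else 0"], goal_cases)
    case (1 w)
    then show ?case by (auto intro: nth_equalityI)
  next
    case (2 w)
    then have "w = map (\<lambda>j. if j < r then w ! j else 0) [0..<r]" by (auto intro: nth_equalityI)
    then have "sum (\<lambda>j. if j < r then w ! j else 0) {..<r} = N"
      using 2 list_sum by (metis (mono_tags, lifting) mem_Collect_eq)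
    then show ?case by (auto simp: splits_def)
  next
    case (3 a)
    then show ?case by (auto simp: splits_def fun_eq_iff)
  next
    case (4 a)
    then show ?case by (simp add: splits_def list_sum)
  next
    case (5 w)
    define a where "a = (\<lambda>j. if j < r then w ! j else 0)"
    have w: "w = map a [0..<r]" using 5 by (auto simp: a_def intro: nth_equalityI)
    have "chi r (\<lambda>j. j + a j) = shat_tuple w"
      using 5 unfolding shat_tuple_eq_chi by (auto intro!: chi_cong simp: a_def add.commute)
    moreover have "prod_list (map (complete_sym i) w) = (\<Prod>j<r. complete_sym i (a j))"
      unfolding w by (simp add: list_prod[symmetric] o_def)
    ultimately show ?case by (simp add: a_def)
  qed
  then have "mfps_nth (\<Sum>w | length w = r \<and> sum_list w = N.
      of_int (shat_tuple w) * prod_list (map (complete_sym i) w)) m =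
    (\<Sum>a\<in>splits {..<r} N. of_int (chi r (\<lambda>j. j + a j)) *
      (\<Sum>q\<in>splits {..<r} m. \<Prod>j<r. of_bool (Poly_Mapping.keys (q j) \<subseteq> ?V \<and> mdeg (q j) = a j)))"
    by (simp add: nth_sum nth_of_int_times nth_prod nth_complete_sym)
  also have "\<dots> = (\<Sum>q\<in>splits {..<r} m. \<Sum>a\<in>splits {..<r} N. of_int (chi r (\<lambda>j. j + a j)) *
      of_bool (\<forall>j<r. Poly_Mapping.keys (q j) \<subseteq> ?V \<and> mdeg (q j) = a j))"
    unfolding sum_distrib_left by (subst sum.swap) (simp add: prod_of_bool Ball_def)
  also have "\<dots> = (\<Sum>q\<in>splits {..<r} m.
      of_int (of_bool (Poly_Mapping.keys m \<subseteq> ?V \<and> mdeg m = N) * chi r (\<lambda>j. j + mdeg (q j))))"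
  proof (rule sum.cong)
    fix q assume q: "q \<in> splits {..<r} m"
    then have m: "m = sum q {..<r}" and q0: "\<And>j. j \<notin> {..<r} \<Longrightarrow> q j = 0" by (auto simp: splits_def)
    have keys: "Poly_Mapping.keys m \<subseteq> ?V \<longleftrightarrow> (\<forall>j<r. Poly_Mapping.keys (q j) \<subseteq> ?V)"
      unfolding m by (subst keys_sum_nat) auto
    have deg: "mdeg m = (\<Sum>j<r. mdeg (q j))"
      unfolding m wdeg_sum ..
    \<comment> \<open>The distribution \<open>q\<close> of the monomial forces the tuple: only
      \<open>a j = mdeg (q j)\<close> contributes, and this tuple has sum \<open>N\<close> precisely
      when \<open>mdeg m = N\<close>.\<close>
    have uniq: "(\<forall>j<r. mdeg (q j) = a j) \<longleftrightarrow> a = (\<lambda>j. mdeg (q j))" if "a \<in> splits {..<r} N" for a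
    proof
      assume *: "\<forall>j<r. mdeg (q j) = a j"
      show "a = (\<lambda>j. mdeg (q j))"
      proof
        fix j show "a j = mdeg (q j)"
          using * that q0[of j] by (cases "j < r") (auto simp: splits_def)
      qed
    qed simp
    have "(\<Sum>a\<in>splits {..<r} N. of_int (chi r (\<lambda>j. j + a j)) *
        of_bool (\<forall>j<r. Poly_Mapping.keys (q j) \<subseteq> ?V \<and> mdeg (q j) = a j)) =
      (\<Sum>a\<in>splits {..<r} N. if a = (\<lambda>j. mdeg (q j)) then
        of_int (of_bool (Poly_Mapping.keys m \<subseteq> ?V) * chi r (\<lambda>j. j + mdeg (q j))) else (0::rat))"
    proof (rule sum.cong)
      fix a assume "a \<in> splits {..<r} N"
      then have "(\<forall>j<r. Poly_Mapping.keys (q j) \<subseteq> ?V \<and> mdeg (q j) = a j) \<longleftrightarrow>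
          Poly_Mapping.keys m \<subseteq> ?V \<and> a = (\<lambda>j. mdeg (q j))"
        unfolding keys using uniq by blast
      then show "of_int (chi r (\<lambda>j. j + a j)) *
          of_bool (\<forall>j<r. Poly_Mapping.keys (q j) \<subseteq> ?V \<and> mdeg (q j) = a j) =
        (if a = (\<lambda>j. mdeg (q j)) then
        of_int (of_bool (Poly_Mapping.keys m \<subseteq> ?V) * chi r (\<lambda>j. j + mdeg (q j))) else (0::rat))"
        by simp
    qed simp
    also have "\<dots> = of_int (of_bool (Poly_Mapping.keys m \<subseteq> ?V \<and> mdeg m = N) * chi r (\<lambda>j. j + mdeg (q j)))"
      using q0 by (subst sum.delta) (rule finite_nat_splits, simp, auto simp: splits_def deg)
    finally show "(\<Sum>a\<in>splits {..<r} N. of_int (chi r (\<lambda>j. j + a j)) *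
        of_bool (\<forall>j<r. Poly_Mapping.keys (q j) \<subseteq> ?V \<and> mdeg (q j) = a j)) =
      (of_int (of_bool (Poly_Mapping.keys m \<subseteq> ?V \<and> mdeg m = N) * chi r (\<lambda>j. j + mdeg (q j))) :: rat)" .
  qed simp
  also have "\<dots> = of_int (of_bool (Poly_Mapping.keys m \<subseteq> ?V \<and> mdeg m = N) *
      (\<Sum>q\<in>splits {..<r} m. chi r (\<lambda>j. j + mdeg (q j))))"
    by (simp add: sum_distrib_left)
  also have "\<dots> = of_bool (Poly_Mapping.keys m \<subseteq> ?V \<and> mdeg m = N \<and> (\<forall>v. r dvd Poly_Mapping.lookup m v))"
  proof -
    \<comment> \<open>The starting vector has its residues already in increasing order.\<close>
    have "chi r (\<lambda>j. j) = 1"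
      unfolding chi_def by (rule prod.neutral) auto
    then show ?thesis
      unfolding sum_chi_splits_monomial[OF assms] by auto
  qed
  finally show ?thesis .
qed

section \<open>Labeled compositions\<close>

lemma bij_choices_Cons:
  "bij_betw (\<lambda>(x, xs). x # xs) (A a \<times> {xs. list_all2 (\<lambda>a x. x \<in> A a) as xs})
    {xs. list_all2 (\<lambda>a x. x \<in> A a) (a # as) xs}"
  by (auto simp: bij_betw_def inj_on_def list_all2_Cons1)

lemma finite_choices:
  assumes "\<And>a. a \<in> set as \<Longrightarrow> finite (A a)"
  shows "finite {xs. list_all2 (\<lambda>a x. x \<in> A a) as xs}"
  using assms
proof (induction as)
  case (Cons a as)
  then have "finite (A a \<times> {xs. list_all2 (\<lambda>a x. x \<in> A a) as xs})" by auto
  then show ?case using bij_betw_finite[OF bij_choices_Cons[of A a as]] by blast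
next
  case Nil
  have "{xs. list_all2 (\<lambda>a x. x \<in> A a) [] xs} = {[]}" by auto
  then show ?case by (simp only: finite.intros)
qed

text \<open>The distributive law for a list of factors. It serves twice: to refine a composition
  part by part, and to assemble a tabloid block by block.\<close>

lemma prod_list_sum_choices:
  fixes f :: "'a \<Rightarrow> 'b \<Rightarrow> 'c::comm_semiring_1"
  shows "prod_list (map (\<lambda>a. sum (f a) (A a)) as) =
    (\<Sum>xs | list_all2 (\<lambda>a x. x \<in> A a) as xs. prod_list (map2 f as xs))"
proof (induction as)
  case (Cons a as)
  let ?X = "{xs. list_all2 (\<lambda>a x. x \<in> A a) as xs}"
  have "(\<Sum>xs | list_all2 (\<lambda>a x. x \<in> A a) (a # as) xs. prod_list (map2 f (a # as) xs)) =
    (\<Sum>(x, xs)\<in>A a \<times> ?X. f a x * prod_list (map2 f as xs))"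
    unfolding sum.reindex_bij_betw[OF bij_choices_Cons, symmetric] by (simp add: case_prod_beta)
  also have "\<dots> = sum (f a) (A a) * (\<Sum>xs\<in>?X. prod_list (map2 f as xs))"
    by (simp add: sum_product sum.cartesian_product)
  also have "(\<Sum>xs\<in>?X. prod_list (map2 f as xs)) = prod_list (map (\<lambda>a. sum (f a) (A a)) as)"
    using Cons by simp
  finally show ?case by simp
qed simp

text \<open>As \<open>h 0 = 1\<close>, the product does not see the zeros of \<open>w\<close>.
  Grouping the tuples by their nonzero entries gives inner sums that are \<open>shat\<close> by
  definition.\<close>

lemma sum_shat_tuple_eq_sum_shat:
  fixes h :: "nat \<Rightarrow> pseries"
  assumes "h 0 = 1"
  shows "(\<Sum>w | length w = r \<and> sum_list w = N. of_int (shat_tuple w) * prod_list (map h w)) =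
    (\<Sum>\<alpha> | \<alpha> \<in> comps N \<and> length \<alpha> \<le> r. of_int (shat r \<alpha>) * prod_list (map h \<alpha>))"
proof -
  let ?W = "{w. length w = r \<and> sum_list w = N}"
  let ?A = "{\<alpha>. \<alpha> \<in> comps N \<and> length \<alpha> \<le> r}"
  let ?g = "filter (\<lambda>x. x \<noteq> (0::nat))"
  have "?W \<subseteq> {w. set w \<subseteq> {..N} \<and> length w = r}"
    using member_le_sum_list by fastforce
  then have finW: "finite ?W"
    by (rule finite_subset) (simp add: finite_lists_length_eq)
  have finA: "finite ?A"
    using finite_comps[of N] by simp
  have sum_g: "sum_list (?g w) = sum_list w" for w
    by (induction w) auto
  have prod_g: "prod_list (map h (?g w)) = prod_list (map h w)" for w
    using assms by (induction w) auto
  have "(\<Sum>w\<in>?W. of_int (shat_tuple w) * prod_list (map h w)) =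
    (\<Sum>\<alpha>\<in>?A. \<Sum>w\<in>{w\<in>?W. ?g w = \<alpha>}. of_int (shat_tuple w) * prod_list (map h w))"
  proof (rule sum.group[symmetric, OF finW finA])
    show "?g ` ?W \<subseteq> ?A"
      using sum_g by (auto simp: comps_def composition_def simp del: neq0_conv)
  qed
  also have "\<dots> = (\<Sum>\<alpha>\<in>?A. of_int (shat r \<alpha>) * prod_list (map h \<alpha>))"
  proof (rule sum.cong)
    fix \<alpha> assume \<alpha>: "\<alpha> \<in> ?A"
    then have eq: "{w\<in>?W. ?g w = \<alpha>} = {w. length w = r \<and> ?g w = \<alpha>}"
      using sum_g by (auto simp: comps_def)
    have "(\<Sum>w\<in>{w\<in>?W. ?g w = \<alpha>}. of_int (shat_tuple w) * prod_list (map h w)) =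
      (\<Sum>w\<in>{w\<in>?W. ?g w = \<alpha>}. of_int (shat_tuple w) * prod_list (map h \<alpha>))"
      by (rule sum.cong) (use prod_g in \<open>auto simp del: neq0_conv\<close>)
    also have "\<dots> = of_int (shat r \<alpha>) * prod_list (map h \<alpha>)"
      using \<alpha> unfolding eq by (simp add: shat_def sum_distrib_right)
    finally show "(\<Sum>w\<in>{w\<in>?W. ?g w = \<alpha>}. of_int (shat_tuple w) * prod_list (map h w)) =
      of_int (shat r \<alpha>) * prod_list (map h \<alpha>)" .
  qed simp
  finally show ?thesis .
qed

text \<open>Labeled compositions with the labels made implicit: the \<open>i\<close>-th segment
  holds the parts labeled \<open>i\<close>. Nonempty segments express that the labels start at 1 and
  use consecutive values; the bound on the length keeps them within
  \<open>1, ..., r\<close>.\<close>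

definition segmentations :: "nat \<Rightarrow> nat \<Rightarrow> nat list list set"
  where "segmentations r N = {bss. length bss \<le> r \<and> (\<forall>\<beta>\<in>set bss. \<beta> \<noteq> [] \<and> composition \<beta>) \<and>
    sum_list (map sum_list bss) = N}"

lemma list_all2_comps:
  "list_all2 (\<lambda>a \<beta>. \<beta> \<in> comps a) \<alpha> bss \<longleftrightarrow> (\<forall>\<beta>\<in>set bss. composition \<beta>) \<and> \<alpha> = map sum_list bss"
  by (induction bss arbitrary: \<alpha>) (auto simp: list_all2_Cons2 comps_def)

lemma composition_sum_pos: "composition \<beta> \<Longrightarrow> sum_list \<beta> > 0 \<longleftrightarrow> \<beta> \<noteq> []"
  by (cases \<beta>) (auto simp: composition_def)

text \<open>Expanding each complete function over compositions of its part replaces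
  \<open>\<alpha>\<close> by a list of compositions, a segmentation. \<open>\<alpha>\<close> is
  recovered from it as \<open>map sum_list bss\<close>, which makes the union over
  \<open>\<alpha>\<close> disjoint.\<close>

lemma sum_shat_complete_sym:
  "(\<Sum>\<alpha> | \<alpha> \<in> comps N \<and> length \<alpha> \<le> r. of_int (shat r \<alpha>) * prod_list (map (complete_sym i) \<alpha>)) =
   (\<Sum>bss\<in>segmentations r N. of_int (shat r (map sum_list bss)) * prod_list (map (signed_elem i) (concat bss)))"
proof -
  let ?A = "{\<alpha>. \<alpha> \<in> comps N \<and> length \<alpha> \<le> r}"
  let ?L = "\<lambda>\<alpha>. {bss. list_all2 (\<lambda>a \<beta>. \<beta> \<in> comps a) \<alpha> bss}"
  let ?f = "\<lambda>bss. of_int (shat r (map sum_list bss)) * prod_list (map (signed_elem i) (concat bss))"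
  have finA: "finite ?A"
    using finite_comps[of N] by simp
  have finL: "finite (?L \<alpha>)" for \<alpha>
    by (rule finite_choices) (rule finite_comps)
  have "of_int (shat r \<alpha>) * prod_list (map (complete_sym i) \<alpha>) = (\<Sum>bss\<in>?L \<alpha>. ?f bss)" for \<alpha>
  proof -
    have "prod_list (map (complete_sym i) \<alpha>) =
      (\<Sum>bss\<in>?L \<alpha>. prod_list (map2 (\<lambda>a \<beta>. prod_list (map (signed_elem i) \<beta>)) \<alpha> bss))"
      unfolding complete_sym_expand by (rule prod_list_sum_choices)
    also have "\<dots> = (\<Sum>bss\<in>?L \<alpha>. prod_list (map (signed_elem i) (concat bss)))"
    proof (rule sum.cong)
      fix bss assume "bss \<in> ?L \<alpha>"
      then have "length \<alpha> = length bss" by (auto dest: list_all2_lengthD)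
      then show "prod_list (map2 (\<lambda>a \<beta>. prod_list (map (signed_elem i) \<beta>)) \<alpha> bss) =
        prod_list (map (signed_elem i) (concat bss))"
        by (induction rule: list_induct2) auto
    qed simp
    finally show ?thesis
      by (auto simp: sum_distrib_left list_all2_comps intro!: sum.cong)
  qed
  then have "(\<Sum>\<alpha>\<in>?A. of_int (shat r \<alpha>) * prod_list (map (complete_sym i) \<alpha>)) = (\<Sum>\<alpha>\<in>?A. \<Sum>bss\<in>?L \<alpha>. ?f bss)"
    by simp
  also have "\<dots> = (\<Sum>bss\<in>(\<Union>\<alpha>\<in>?A. ?L \<alpha>). ?f bss)"
    by (rule sum.UNION_disjoint[symmetric]) (use finA finL in \<open>auto simp: list_all2_comps\<close>)
  also have "(\<Union>\<alpha>\<in>?A. ?L \<alpha>) = segmentations r N"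
  proof (rule set_eqI)
    fix bss
    have "bss \<in> (\<Union>\<alpha>\<in>?A. ?L \<alpha>) \<longleftrightarrow> (\<forall>\<beta>\<in>set bss. composition \<beta>) \<and> map sum_list bss \<in> ?A"
      unfolding list_all2_comps by auto
    also have "\<dots> \<longleftrightarrow> bss \<in> segmentations r N"
    proof -
      have "composition (map sum_list bss) \<longleftrightarrow> [] \<notin> set bss" if "\<forall>\<beta>\<in>set bss. composition \<beta>"
      proof -
        have "0 \<notin> S \<longleftrightarrow> (\<forall>x\<in>S. 0 < x)" for S :: "nat set"
          by (metis gr0I less_irrefl)
        then have "composition (map sum_list bss) \<longleftrightarrow> (\<forall>\<beta>\<in>set bss. 0 < sum_list \<beta>)"
          unfolding composition_def set_map by simp
        also have "\<dots> \<longleftrightarrow> (\<forall>\<beta>\<in>set bss. \<beta> \<noteq> [])"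
          using that composition_sum_pos by blast
        finally show ?thesis by blast
      qed
      then show ?thesis
        by (auto simp: comps_def segmentations_def)
    qed
    finally show "bss \<in> (\<Union>\<alpha>\<in>?A. ?L \<alpha>) \<longleftrightarrow> bss \<in> segmentations r N" .
  qed
  finally show ?thesis .
qed

text \<open>The first label \<open>k\<close> is a parameter only so that inductions go through;
  actual labelings start at 1.\<close>

fun segment_labels :: "nat \<Rightarrow> 'a list list \<Rightarrow> nat list"
  where
    "segment_labels k [] = []"
  | "segment_labels k (\<beta> # bss) = replicate (length \<beta>) k @ segment_labels (Suc k) bss"

lemma length_segment_labels: "length (segment_labels k bss) = length (concat bss)"
  by (induction bss arbitrary: k) auto

lemma set_segment_labels:
  "[] \<notin> set bss \<Longrightarrow> set (segment_labels k bss) = {k..<k + length bss}"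
  by (induction bss arbitrary: k) (auto simp: atLeastLessThan_def)

lemma segment_labels_ge: "x \<in> set (segment_labels k bss) \<Longrightarrow> k \<le> x"
  by (induction bss arbitrary: k) (auto dest: Suc_leD)

lemma sorted_segment_labels: "sorted (segment_labels k bss)"
  by (induction bss arbitrary: k) (auto simp: sorted_append dest: segment_labels_ge)

lemma filter_segment_labels:
  "filter (\<lambda>x. x = k) (segment_labels (Suc k) bss) = []"
  by (auto simp: filter_empty_conv dest: segment_labels_ge)

text \<open>All labels after the first segment exceed \<open>k\<close>, so the number of entries
  \<open>k\<close> is the length of the first segment.\<close>

lemma segment_labels_inject:
  "[] \<notin> set bss \<Longrightarrow> [] \<notin> set bss' \<Longrightarrow> segment_labels k bss = segment_labels k bss' \<Longrightarrow>
    concat bss = concat bss' \<Longrightarrow> bss = bss'"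
proof (induction bss arbitrary: k bss')
  case Nil
  then show ?case by (cases bss') auto
next
  case (Cons \<beta> bss)
  then obtain \<beta>' cs where b': "bss' = \<beta>' # cs"
    by (cases bss') auto
  have "filter (\<lambda>x. x = k) (segment_labels k (\<beta> # bss)) = filter (\<lambda>x. x = k) (segment_labels k (\<beta>' # cs))"
    using Cons.prems b' by simp
  then have "length \<beta> = length \<beta>'"
    by (simp add: filter_segment_labels)
  then show ?case
    using Cons.prems Cons.IH[of cs "Suc k"] by (auto simp: b')
qed

lemma sorted_filter_split:
  "sorted L \<Longrightarrow> \<forall>x\<in>set L. k \<le> x \<Longrightarrow> L = replicate (length (filter (\<lambda>x. x = k) L)) k @ filter (\<lambda>x. x \<noteq> k) L"
  for L :: "nat list"
proof (induction L)
  case (Cons a L)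
  show ?case
  proof (cases "a = k")
    case False
    then have "\<forall>x\<in>set L. x \<noteq> k" using Cons.prems by auto
    then have "filter (\<lambda>x. x = k) L = []" "filter (\<lambda>x. x \<noteq> k) L = L"
      by (auto simp: filter_empty_conv filter_id_conv)
    then show ?thesis using False by simp
  qed (use Cons in auto)
qed simp

text \<open>In a sorted list the entries equal to the minimum \<open>k\<close> form an initial run.
  Its length cuts off the first segment, which is nonempty since \<open>k\<close> occurs.\<close>

lemma segment_labels_surj:
  "sorted L \<Longrightarrow> set L = {k..<k + m} \<Longrightarrow> length \<beta> = length L \<Longrightarrow>
    \<exists>bss. length bss = m \<and> [] \<notin> set bss \<and> concat bss = \<beta> \<and> segment_labels k bss = L"
proof (induction m arbitrary: k L \<beta>)
  case 0
  then show ?case by auto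
next
  case (Suc m)
  define n where "n = length (filter (\<lambda>x. x = k) L)"
  define L' where "L' = filter (\<lambda>x. x \<noteq> k) L"
  have L: "L = replicate n k @ L'"
    unfolding n_def L'_def using Suc.prems by (intro sorted_filter_split) auto
  have "k \<in> set L" using Suc.prems by simp
  then have n: "n > 0" by (auto simp: n_def filter_empty_conv)
  have "set L' = {k..<k + Suc m} - {k}"
    unfolding L'_def set_filter Suc.prems(2) by blast
  also have "\<dots> = {Suc k..<Suc k + m}" by (rule set_eqI) auto
  finally have "set L' = {Suc k..<Suc k + m}" .
  moreover have "sorted L'" using Suc.prems by (simp add: L'_def sorted_wrt_filter)
  moreover have "length (drop n \<beta>) = length L'" using Suc.prems(3) L by simp
  ultimately obtain bss where bss: "length bss = m" "[] \<notin> set bss" "concat bss = drop n \<beta>"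
      "segment_labels (Suc k) bss = L'"
    using Suc.IH by blast
  have "n \<le> length \<beta>" using Suc.prems(3) L by simp
  then have "length (take n \<beta> # bss) = Suc m \<and> [] \<notin> set (take n \<beta> # bss) \<and>
      concat (take n \<beta> # bss) = \<beta> \<and> segment_labels k (take n \<beta> # bss) = L"
    using bss n by (auto simp: L min_def)
  then show ?case by blast
qed

text \<open>One height of the ordered type of a labeling, computed from the parts themselves instead
  of from box counts divided by the height.\<close>

definition label_sums :: "nat list \<Rightarrow> nat list \<Rightarrow> nat list"
  where "label_sums \<beta> L = map (\<lambda>i. \<Sum>j | j < length L \<and> L ! j = i. \<beta> ! j) [1..<Suc (card (set L))]"

lemma sum_nth_eq_sum_list_filter:
  fixes \<beta> :: "nat list"
  assumes "length \<beta> = length L"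
  shows "(\<Sum>j | j < length L \<and> L ! j = i. \<beta> ! j) = sum_list (map fst (filter (\<lambda>p. snd p = i) (zip \<beta> L)))"
proof -
  have "(\<Sum>j | j < length L \<and> L ! j = i. \<beta> ! j) = (\<Sum>j\<in>{0..<length L}. if L ! j = i then \<beta> ! j else 0)"
    by (subst sum.inter_filter[symmetric]) (auto intro!: sum.cong)
  also have "\<dots> = sum_list (map (\<lambda>p. if snd p = i then fst p else 0) (zip \<beta> L))"
    using assms by (subst sum_list_sum_nth) (auto intro!: sum.cong)
  finally show ?thesis by (simp add: sum_list_map_filter')
qed

text \<open>Selecting label \<open>k\<close> keeps exactly the first segment, since later labels are
  larger; for larger labels the first segment drops out and the induction hypothesis
  applies.\<close>

lemma sums_segment_labels:
  "map (\<lambda>i. sum_list (map fst (filter (\<lambda>p. snd p = i) (zip (concat bss) (segment_labels k bss))))) [k..<k + length bss] =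
    map sum_list bss"
proof (induction bss arbitrary: k)
  case (Cons \<beta> bss)
  let ?T = "\<lambda>i xs. sum_list (map fst (filter (\<lambda>p. snd p = i) xs))"
  have z: "zip (concat (\<beta> # bss)) (segment_labels k (\<beta> # bss)) =
      zip \<beta> (replicate (length \<beta>) k) @ zip (concat bss) (segment_labels (Suc k) bss)"
    by simp
  have 1: "filter (\<lambda>p. snd p = k) (zip \<beta> (replicate (length \<beta>) k)) = zip \<beta> (replicate (length \<beta>) k)"
    by (auto simp: filter_id_conv dest: set_zip_rightD)
  have 2: "filter (\<lambda>p. snd p = k) (zip (concat bss) (segment_labels (Suc k) bss)) = []"
    by (auto simp: filter_empty_conv dest!: set_zip_rightD segment_labels_ge)
  have 3: "filter (\<lambda>p. snd p = i) (zip \<beta> (replicate (length \<beta>) k)) = []" if "k < i" for i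
    using that by (auto simp: filter_empty_conv dest!: set_zip_rightD)
  have "map (\<lambda>i. ?T i (zip (concat (\<beta> # bss)) (segment_labels k (\<beta> # bss)))) [k..<k + length (\<beta> # bss)] =
    ?T k (zip (concat (\<beta> # bss)) (segment_labels k (\<beta> # bss))) #
    map (\<lambda>i. ?T i (zip (concat (\<beta> # bss)) (segment_labels k (\<beta> # bss)))) [Suc k..<Suc k + length bss]"
    by (simp only: upt_conv_Cons list.map list.size add_Suc_right add_Suc add_0_right)
  also have "?T k (zip (concat (\<beta> # bss)) (segment_labels k (\<beta> # bss))) = sum_list \<beta>"
    unfolding z filter_append 1 2 by simp
  also have "map (\<lambda>i. ?T i (zip (concat (\<beta> # bss)) (segment_labels k (\<beta> # bss)))) [Suc k..<Suc k + length bss] =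
      map (\<lambda>i. ?T i (zip (concat bss) (segment_labels (Suc k) bss))) [Suc k..<Suc k + length bss]"
    unfolding z filter_append by (intro map_cong refl) (simp add: 3 del: upt_Suc)
  also have "\<dots> = map sum_list bss"
    by (rule Cons.IH)
  finally show ?case by simp
qed simp

lemma label_sums_segment_labels:
  assumes "[] \<notin> set bss"
  shows "label_sums (concat bss) (segment_labels 1 bss) = map sum_list bss"
proof -
  have "card (set (segment_labels 1 bss)) = length bss"
    using set_segment_labels[OF assms, of 1] by simp
  then show ?thesis
    using sums_segment_labels[of bss 1]
    unfolding label_sums_def sum_nth_eq_sum_list_filter[OF length_segment_labels[symmetric]] by simp
qed

section \<open>Labelings of a composition and their weights\<close>

definition labelings :: "nat \<Rightarrow> nat list \<Rightarrow> nat list set"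
  where "labelings r \<beta> = {L. length L = length \<beta> \<and> valid_labels r L}"

lemma finite_labelings: "finite (labelings r \<beta>)"
  by (rule finite_subset[of _ "{L. set L \<subseteq> {1..r} \<and> length L = length \<beta>}"])
    (auto simp: labelings_def valid_labels_def finite_lists_length_eq)

lemma bij_segmentations:
  "bij_betw (\<lambda>bss. (concat bss, segment_labels 1 bss)) (segmentations r N) (SIGMA \<beta>:comps N. labelings r \<beta>)"
proof (rule bij_betw_imageI)
  show "inj_on (\<lambda>bss. (concat bss, segment_labels 1 bss)) (segmentations r N)"
    by (rule inj_onI) (auto simp: segmentations_def intro!: segment_labels_inject)
  have sc: "sum_list (concat bss) = sum_list (map sum_list bss)" for bss :: "nat list list"
    by (induction bss) auto
  show "(\<lambda>bss. (concat bss, segment_labels 1 bss)) ` segmentations r N = (SIGMA \<beta>:comps N. labelings r \<beta>)"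
  proof (intro equalityI subsetI)
    fix x assume "x \<in> (\<lambda>bss. (concat bss, segment_labels 1 bss)) ` segmentations r N"
    then obtain bss where x: "x = (concat bss, segment_labels 1 bss)" "bss \<in> segmentations r N" by auto
    then have "set (segment_labels 1 bss) = {1..length bss}" "length bss \<le> r"
      using set_segment_labels[of bss 1] by (auto simp: segmentations_def atLeastLessThanSuc_atLeastAtMost)
    then have "valid_labels r (segment_labels 1 bss)"
      unfolding valid_labels_def using sorted_segment_labels by blast
    then show "x \<in> (SIGMA \<beta>:comps N. labelings r \<beta>)"
      using x by (auto simp: labelings_def comps_def composition_def segmentations_def sc length_segment_labels)
  next
    fix x assume "x \<in> (SIGMA \<beta>:comps N. labelings r \<beta>)"
    then obtain \<beta> L m where x: "x = (\<beta>, L)" "\<beta> \<in> comps N" "length L = length \<beta>" "sorted L" "m \<le> r" "set L = {1..<1 + m}"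
      by (auto simp: labelings_def valid_labels_def atLeastLessThanSuc_atLeastAtMost)
    then obtain bss where bss: "length bss = m" "[] \<notin> set bss" "concat bss = \<beta>" "segment_labels 1 bss = L"
      using segment_labels_surj[of L 1 m \<beta>] by auto
    then have "bss \<in> segmentations r N"
      using x sc[of bss] by (auto simp: segmentations_def comps_def composition_def)
    then show "x \<in> (\<lambda>bss. (concat bss, segment_labels 1 bss)) ` segmentations r N"
      using bss x by (auto simp: image_iff)
  qed
qed

text \<open>The share of a single height in \<open>psgn_lpw\<close>, which is the product of these
  shares.\<close>

definition labeled_weight :: "nat \<Rightarrow> nat list \<Rightarrow> nat list \<Rightarrow> int"
  where "labeled_weight r \<beta> L = (- 1) ^ (sum_list \<beta> - length \<beta>) * shat r (label_sums \<beta> L)"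

lemma length_le_sum_list: "composition \<beta> \<Longrightarrow> length \<beta> \<le> sum_list \<beta>"
  by (induction \<beta>) (auto simp: composition_def)

lemma prod_list_signed_elem:
  "composition \<beta> \<Longrightarrow> prod_list (map (signed_elem i) \<beta>) =
    (- 1) ^ (sum_list \<beta> - length \<beta>) * prod_list (map (elem_sym i) \<beta>)"
proof (induction \<beta>)
  case (Cons b \<beta>)
  then have c: "composition \<beta>" "b \<ge> 1" by (auto simp: composition_def)
  \<comment> \<open>Truncated subtraction is additive here because a composition never has more
    parts than its sum.\<close>
  then have "sum_list (b # \<beta>) - length (b # \<beta>) = (b - 1) + (sum_list \<beta> - length \<beta>)"
    using length_le_sum_list[of \<beta>] by simp
  then show ?case
    using Cons.IH[OF c(1)] by (simp add: signed_elem_def power_add mult_ac)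
qed simp

text \<open>The plethysm in the form that matches polywrappings: tuples lose their zeros, the
  resulting compositions are refined to segmentations, and these are labeled compositions.\<close>

lemma nth_sum_labeled_weight:
  assumes "r > 0"
  shows "mfps_nth (\<Sum>\<beta>\<in>comps N. \<Sum>L\<in>labelings r \<beta>.
      of_int (labeled_weight r \<beta> L) * prod_list (map (elem_sym i) \<beta>)) m =
    of_bool (Poly_Mapping.keys m \<subseteq> {i} \<times> {1..} \<and> mdeg m = N \<and> (\<forall>v. r dvd Poly_Mapping.lookup m v))"
proof -
  have "(\<Sum>\<beta>\<in>comps N. \<Sum>L\<in>labelings r \<beta>. of_int (labeled_weight r \<beta> L) * prod_list (map (elem_sym i) \<beta>)) =
    (\<Sum>(\<beta>, L)\<in>(SIGMA \<beta>:comps N. labelings r \<beta>). of_int (labeled_weight r \<beta> L) * prod_list (map (elem_sym i) \<beta>))"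
    by (rule sum.Sigma) (auto simp: finite_comps finite_labelings)
  also have "\<dots> = (\<Sum>bss\<in>segmentations r N. of_int (labeled_weight r (concat bss) (segment_labels 1 bss)) *
      prod_list (map (elem_sym i) (concat bss)))"
    unfolding sum.reindex_bij_betw[OF bij_segmentations, symmetric] by simp
  also have "\<dots> = (\<Sum>bss\<in>segmentations r N.
      of_int (shat r (map sum_list bss)) * prod_list (map (signed_elem i) (concat bss)))"
  proof (rule sum.cong)
    fix bss assume "bss \<in> segmentations r N"
    then have "[] \<notin> set bss" "composition (concat bss)"
      by (auto simp: segmentations_def composition_def)
    then show "of_int (labeled_weight r (concat bss) (segment_labels 1 bss)) * prod_list (map (elem_sym i) (concat bss)) =
      of_int (shat r (map sum_list bss)) * prod_list (map (signed_elem i) (concat bss))"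
      using label_sums_segment_labels[of bss]
      by (simp add: labeled_weight_def prod_list_signed_elem mult_ac del: map_concat)
  qed simp
  also have "\<dots> = (\<Sum>w | length w = r \<and> sum_list w = N. of_int (shat_tuple w) * prod_list (map (complete_sym i) w))"
    unfolding sum_shat_complete_sym[symmetric]
    by (rule sum_shat_tuple_eq_sum_shat[symmetric]) (rule complete_sym_0)
  finally show ?thesis
    using nth_sum_shat_tuple[OF assms] by simp
qed

section \<open>Expansion of a block\<close>

text \<open>Serves to isolate the terms of one degree when a product of truncated series is
  multiplied out; the zero series qualifies for every degree.\<close>

definition homogeneous :: "nat \<Rightarrow> pseries \<Rightarrow> bool"
  where "homogeneous N f \<longleftrightarrow> (\<forall>m. mfps_nth f m \<noteq> 0 \<longrightarrow> pdegree m = N)"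

lemma homogeneous_1: "homogeneous 0 1"
  by (simp add: homogeneous_def one_mfps.rep_eq pdegree_eq_wdeg)

lemma homogeneous_mult:
  assumes "homogeneous M f" "homogeneous N g"
  shows "homogeneous (M + N) (f * g)"
  unfolding homogeneous_def
proof (intro allI impI)
  fix m assume "mfps_nth (f * g) m \<noteq> 0"
  then obtain x where "x \<in> {(a, b). a + b = m}" "(case x of (a, b) \<Rightarrow> mfps_nth f a * mfps_nth g b) \<noteq> 0"
    unfolding times_mfps.rep_eq by (rule sum.not_neutral_contains_not_neutral)
  then obtain a b where "a + b = m" "mfps_nth f a * mfps_nth g b \<noteq> 0"
    by (cases x) simp
  then show "pdegree m = M + N"
    using assms by (auto simp: homogeneous_def pdegree_eq_wdeg wdeg_add)
qed

lemma homogeneous_of_int_mult: "homogeneous N f \<Longrightarrow> homogeneous N (of_int c * f)"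
  by (auto simp: homogeneous_def nth_of_int_times)

lemma homogeneous_prod:
  "(\<And>i. i \<in> I \<Longrightarrow> homogeneous (N i) (f i)) \<Longrightarrow> homogeneous (sum N I) (prod f I)"
  by (induction I rule: infinite_finite_induct) (auto intro: homogeneous_1 homogeneous_mult)

lemma homogeneous_elem_sym: "homogeneous (i * k) (elem_sym i k)"
  unfolding homogeneous_def
proof (intro allI impI)
  fix m assume "mfps_nth (elem_sym i k) m \<noteq> 0"
  then have m: "Poly_Mapping.keys m \<subseteq> {i} \<times> {1..}" "mdeg m = k"
    by (auto simp: nth_elem_sym)
  have "pdegree m = (\<Sum>v\<in>Poly_Mapping.keys m. i * Poly_Mapping.lookup m v)"
    unfolding pdegree_def using m(1) by (intro sum.cong) auto
  then show "pdegree m = i * k"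
    using m(2) by (simp add: wdeg_def sum_distrib_left[symmetric])
qed

lemma homogeneous_prod_elem_sym: "homogeneous (i * sum_list \<beta>) (prod_list (map (elem_sym i) \<beta>))"
  by (induction \<beta>) (auto simp: distrib_left intro: homogeneous_1 homogeneous_mult homogeneous_elem_sym)

section \<open>Splitting a monomial along disjoint families of variables\<close>

definition restrict_monomial :: "'v set \<Rightarrow> ('v \<Rightarrow>\<^sub>0 nat) \<Rightarrow> 'v \<Rightarrow>\<^sub>0 nat"
  where "restrict_monomial A m = (\<Sum>v\<in>Poly_Mapping.keys m \<inter> A. Poly_Mapping.single v (Poly_Mapping.lookup m v))"

lemma lookup_restrict_monomial:
  "Poly_Mapping.lookup (restrict_monomial A m) v = (if v \<in> A then Poly_Mapping.lookup m v else 0)"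
proof -
  have "Poly_Mapping.lookup (restrict_monomial A m) v =
    (\<Sum>u\<in>Poly_Mapping.keys m \<inter> A. if u = v then Poly_Mapping.lookup m v else 0)"
    unfolding restrict_monomial_def lookup_sum lookup_single when_def by (rule sum.cong) auto
  then show ?thesis by (auto simp: in_keys_iff)
qed

lemma keys_restrict_monomial: "Poly_Mapping.keys (restrict_monomial A m) = Poly_Mapping.keys m \<inter> A"
  by (auto simp: in_keys_iff lookup_restrict_monomial split: if_splits)

text \<open>Factors in disjoint sets of variables leave no choice: each must receive the part of
  \<open>m\<close> in its own variables. A coefficient of such a product is then a single term or
  0.\<close>

lemma splits_disjoint_supports:
  fixes m :: "'v \<Rightarrow>\<^sub>0 nat"
  assumes "finite I" "\<And>i j. i \<in> I \<Longrightarrow> j \<in> I \<Longrightarrow> i \<noteq> j \<Longrightarrow> V i \<inter> V j = {}"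
  shows "{q\<in>splits I m. \<forall>i\<in>I. Poly_Mapping.keys (q i) \<subseteq> V i} =
    (if Poly_Mapping.keys m \<subseteq> (\<Union>i\<in>I. V i) then {\<lambda>i. if i \<in> I then restrict_monomial (V i) m else 0} else {})"
proof -
  have lookup_q: "Poly_Mapping.lookup m v = Poly_Mapping.lookup (q i) v"
    if "q \<in> splits I m" "\<forall>i\<in>I. Poly_Mapping.keys (q i) \<subseteq> V i" "i \<in> I" "v \<in> V i" for q i v
  proof -
    have "Poly_Mapping.lookup m v = (\<Sum>j\<in>I. Poly_Mapping.lookup (q j) v)"
      using that(1) by (auto simp: splits_def lookup_sum)
    also have "\<dots> = (\<Sum>j\<in>I. if j = i then Poly_Mapping.lookup (q i) v else 0)"
    proof (rule sum.cong)
      fix j assume j: "j \<in> I"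
      show "Poly_Mapping.lookup (q j) v = (if j = i then Poly_Mapping.lookup (q i) v else 0)"
      proof (cases "j = i")
        case False
        then have "v \<notin> V j" using assms(2)[OF j that(3)] that(4) by auto
        then have "v \<notin> Poly_Mapping.keys (q j)" using that(2) j by auto
        then show ?thesis using False by (simp add: in_keys_iff)
      qed simp
    qed simp
    finally show ?thesis using assms(1) that(3) by simp
  qed
  show ?thesis
  proof (cases "Poly_Mapping.keys m \<subseteq> (\<Union>i\<in>I. V i)")
    case True
    let ?q = "\<lambda>i. if i \<in> I then restrict_monomial (V i) m else 0"
    have "sum ?q I = m"
    proof (rule poly_mapping_eqI)
      fix v
      have "Poly_Mapping.lookup (sum ?q I) v = (\<Sum>i\<in>I. if v \<in> V i then Poly_Mapping.lookup m v else 0)"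
        unfolding lookup_sum by (rule sum.cong) (auto simp: lookup_restrict_monomial)
      also have "\<dots> = Poly_Mapping.lookup m v"
      proof (cases "Poly_Mapping.lookup m v = 0")
        case False
        then have "v \<in> Poly_Mapping.keys m" by (simp add: in_keys_iff)
        then obtain i where i: "i \<in> I" "v \<in> V i" using True by blast
        then have "(\<Sum>i\<in>I. if v \<in> V i then Poly_Mapping.lookup m v else 0) =
            (\<Sum>j\<in>I. if j = i then Poly_Mapping.lookup m v else 0)"
          using assms(2) by (intro sum.cong) fastforce+
        then show ?thesis using i assms(1) by simp
      qed (simp cong: if_cong)
      finally show "Poly_Mapping.lookup (sum ?q I) v = Poly_Mapping.lookup m v" .
    qed
    then have "?q \<in> {q\<in>splits I m. \<forall>i\<in>I. Poly_Mapping.keys (q i) \<subseteq> V i}"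
      by (auto simp: splits_def keys_restrict_monomial)
    moreover have "q = ?q" if q: "q \<in> splits I m" "\<forall>i\<in>I. Poly_Mapping.keys (q i) \<subseteq> V i" for q
    proof
      fix i
      show "q i = ?q i"
      proof (cases "i \<in> I")
        case i: True
        have "q i = restrict_monomial (V i) m"
        proof (rule poly_mapping_eqI)
          fix v
          show "Poly_Mapping.lookup (q i) v = Poly_Mapping.lookup (restrict_monomial (V i) m) v"
          proof (cases "v \<in> V i")
            case False
            then have "v \<notin> Poly_Mapping.keys (q i)" using q(2) i by auto
            then show ?thesis using False by (simp add: lookup_restrict_monomial in_keys_iff)
          qed (use lookup_q[OF q i] in \<open>simp add: lookup_restrict_monomial\<close>)
        qed
        then show ?thesis using i by simp
      qed (use q in \<open>simp add: splits_def\<close>)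
    qed
    ultimately have "{q\<in>splits I m. \<forall>i\<in>I. Poly_Mapping.keys (q i) \<subseteq> V i} = {?q}" by blast
    then show ?thesis using True by simp
  next
    case False
    have "Poly_Mapping.keys m \<subseteq> (\<Union>i\<in>I. V i)" if "q \<in> splits I m" "\<forall>i\<in>I. Poly_Mapping.keys (q i) \<subseteq> V i" for q
      using that keys_sum_nat[OF assms(1), of q] by (auto simp: splits_def)
    then have "{q\<in>splits I m. \<forall>i\<in>I. Poly_Mapping.keys (q i) \<subseteq> V i} = {}"
      using False by blast
    then show ?thesis using False by simp
  qed
qed

section \<open>Truncated generating series for one family of variables\<close>

definition bounded_comps :: "nat \<Rightarrow> nat \<Rightarrow> nat list set"
  where "bounded_comps r N = {\<beta>. composition \<beta> \<and> r dvd sum_list \<beta> \<and> sum_list \<beta> \<le> N}"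

lemma bounded_comps_eq: "bounded_comps r N = (\<Union>a\<in>{a. a \<le> N \<and> r dvd a}. comps a)"
  by (auto simp: bounded_comps_def comps_def)

lemma finite_bounded_comps: "finite (bounded_comps r N)"
  by (simp add: bounded_comps_eq finite_comps)

text \<open>The product of \<open>1 / (1 - x_kj^r)\<close> over all \<open>j\<close>, truncated at
  degree \<open>N\<close> with each variable counted once. The terms of one area sum to a plethysm;
  the truncation keeps the sum finite.\<close>

definition power_series :: "nat \<Rightarrow> nat \<Rightarrow> nat \<Rightarrow> pseries"
  where "power_series r N k = (\<Sum>(\<beta>, L)\<in>(SIGMA \<beta>:bounded_comps r N. labelings r \<beta>).
    of_int (labeled_weight r \<beta> L) * prod_list (map (elem_sym k) \<beta>))"

lemma dvd_mdeg: "\<forall>v. r dvd Poly_Mapping.lookup m v \<Longrightarrow> r dvd wdeg f m"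
  unfolding wdeg_def by (rule dvd_sum) auto

lemma nth_power_series:
  assumes "r > 0"
  shows "mfps_nth (power_series r N k) m =
    of_bool (Poly_Mapping.keys m \<subseteq> {k} \<times> {1..} \<and> mdeg m \<le> N \<and> (\<forall>v. r dvd Poly_Mapping.lookup m v))"
proof -
  let ?f = "\<lambda>\<beta>. \<Sum>L\<in>labelings r \<beta>. of_int (labeled_weight r \<beta> L) * prod_list (map (elem_sym k) \<beta>)"
  have "power_series r N k = (\<Sum>\<beta>\<in>bounded_comps r N. ?f \<beta>)"
    unfolding power_series_def
    by (rule sum.Sigma[symmetric]) (auto simp: finite_bounded_comps finite_labelings)
  also have "\<dots> = (\<Sum>a | a \<le> N \<and> r dvd a. \<Sum>\<beta>\<in>comps a. ?f \<beta>)"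
    unfolding bounded_comps_eq by (rule sum.UNION_disjoint) (auto simp: finite_comps, auto simp: comps_def)
  finally have "mfps_nth (power_series r N k) m = (\<Sum>a | a \<le> N \<and> r dvd a.
      of_bool (Poly_Mapping.keys m \<subseteq> {k} \<times> {1..} \<and> mdeg m = a \<and> (\<forall>v. r dvd Poly_Mapping.lookup m v)))"
    by (simp only: nth_sum[of _ "{a. a \<le> N \<and> r dvd a}"] nth_sum_labeled_weight[OF assms])
  \<comment> \<open>The index \<open>a = mdeg m\<close> is a multiple of \<open>r\<close> as soon as
    all exponents are, so the divisibility condition on \<open>a\<close> loses nothing.\<close>
  also have "\<dots> = (\<Sum>a | a \<le> N \<and> r dvd a. if a = mdeg m then
      of_bool (Poly_Mapping.keys m \<subseteq> {k} \<times> {1..} \<and> (\<forall>v. r dvd Poly_Mapping.lookup m v)) else 0)"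
    by (rule sum.cong) auto
  also have "\<dots> = of_bool (Poly_Mapping.keys m \<subseteq> {k} \<times> {1..} \<and> mdeg m \<le> N \<and> (\<forall>v. r dvd Poly_Mapping.lookup m v))"
    using dvd_mdeg[of r m "\<lambda>_. Suc 0"]
    by (cases "\<forall>v. r dvd Poly_Mapping.lookup m v") simp_all
  finally show ?thesis .
qed

text \<open>In degree \<open>N\<close> neither truncation shows: a variable \<open>x_kj\<close> in
  \<open>pvars\<close> that divides \<open>m\<close> has \<open>k \<le> N\<close>, and since its
  weight is at least 1, no more than \<open>N\<close> of them occur with multiplicity.\<close>

lemma nth_prod_power_series:
  assumes "r > 0" "pdegree m = N"
  shows "mfps_nth (\<Prod>k\<in>{1..N}. power_series r N k) m =
    of_bool (Poly_Mapping.keys m \<subseteq> pvars \<and> (\<forall>v. r dvd Poly_Mapping.lookup m v))"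
proof -
  let ?V = "\<lambda>k. {k} \<times> {1..} :: (nat \<times> nat) set"
  have disj: "?V i \<inter> ?V j = {}" if "i \<noteq> j" for i j
    using that by auto
  have deg: "fst v * Poly_Mapping.lookup m v \<le> N" if "v \<in> Poly_Mapping.keys m" for v
    using assms(2) that unfolding pdegree_def by (metis (no_types, lifting) finite_keys member_le_sum zero_le)
  have keys: "Poly_Mapping.keys m \<subseteq> (\<Union>k\<in>{1..N}. ?V k) \<longleftrightarrow> Poly_Mapping.keys m \<subseteq> pvars"
  proof
    assume *: "Poly_Mapping.keys m \<subseteq> pvars"
    show "Poly_Mapping.keys m \<subseteq> (\<Union>k\<in>{1..N}. ?V k)"
    proof
      fix v assume v: "v \<in> Poly_Mapping.keys m"
      then have "Poly_Mapping.lookup m v \<ge> 1" by (simp add: in_keys_iff)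
      then have "fst v \<le> fst v * Poly_Mapping.lookup m v" by simp
      then have "fst v \<le> N" using deg[OF v] by linarith
      moreover have "v \<in> pvars" using v * by blast
      ultimately show "v \<in> (\<Union>k\<in>{1..N}. ?V k)"
        by (cases v) (auto simp: pvars_def)
    qed
  qed (auto simp: pvars_def)
  have mdeg: "mdeg (restrict_monomial (?V k) m) \<le> N" if "k \<in> {1..N}" for k
  proof -
    have "mdeg (restrict_monomial (?V k) m) = (\<Sum>v\<in>Poly_Mapping.keys m \<inter> ?V k. Poly_Mapping.lookup m v)"
      by (simp add: wdeg_def keys_restrict_monomial lookup_restrict_monomial)
    also have "\<dots> \<le> (\<Sum>v\<in>Poly_Mapping.keys m \<inter> ?V k. fst v * Poly_Mapping.lookup m v)"
      using that by (intro sum_mono) auto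
    also have "\<dots> \<le> pdegree m"
      unfolding pdegree_def by (rule sum_mono2) auto
    finally show ?thesis using assms(2) by simp
  qed
  have "mfps_nth (\<Prod>k\<in>{1..N}. power_series r N k) m =
    (\<Sum>q\<in>splits {1..N} m. of_bool (\<forall>k\<in>{1..N}. Poly_Mapping.keys (q k) \<subseteq> ?V k \<and> mdeg (q k) \<le> N \<and>
      (\<forall>v. r dvd Poly_Mapping.lookup (q k) v)))"
    by (simp only: nth_prod finite_atLeastAtMost nth_power_series[OF assms(1)] prod_of_bool)
  also have "\<dots> = (\<Sum>q\<in>{q\<in>splits {1..N} m. \<forall>k\<in>{1..N}. Poly_Mapping.keys (q k) \<subseteq> ?V k}.
      of_bool (\<forall>k\<in>{1..N}. mdeg (q k) \<le> N \<and> (\<forall>v. r dvd Poly_Mapping.lookup (q k) v)))"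
    unfolding sum.inter_filter[OF finite_monomial_splits[OF finite_atLeastAtMost]]
    by (rule sum.cong) auto
  also have "\<dots> = of_bool (Poly_Mapping.keys m \<subseteq> pvars \<and> (\<forall>v. r dvd Poly_Mapping.lookup m v))"
  proof (cases "Poly_Mapping.keys m \<subseteq> pvars")
    case True
    have "(\<forall>k\<in>{1..N}. \<forall>v. r dvd Poly_Mapping.lookup (restrict_monomial (?V k) m) v) \<longleftrightarrow>
        (\<forall>v. r dvd Poly_Mapping.lookup m v)"
    proof
      assume *: "\<forall>k\<in>{1..N}. \<forall>v. r dvd Poly_Mapping.lookup (restrict_monomial (?V k) m) v"
      show "\<forall>v. r dvd Poly_Mapping.lookup m v"
      proof
        fix v
        show "r dvd Poly_Mapping.lookup m v"
        proof (cases "v \<in> Poly_Mapping.keys m")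
          case v: True
          then obtain k where "k \<in> {1..N}" "v \<in> ?V k" using keys True by blast
          then show ?thesis using * by (metis lookup_restrict_monomial)
        qed (simp add: in_keys_iff)
      qed
    qed (simp add: lookup_restrict_monomial)
    then show ?thesis
      using True keys mdeg by (subst splits_disjoint_supports) (auto simp: disj)
  next
    case False
    then show ?thesis
      using keys by (subst splits_disjoint_supports) (auto simp: disj)
  qed
  finally show ?thesis .
qed

lemma nth_H_block:
  assumes "r > 0"
  shows "mfps_nth (H_block (d, r)) m =
    of_bool (Poly_Mapping.keys m \<subseteq> pvars \<and> pdegree m = d * r \<and> (\<forall>v. r dvd Poly_Mapping.lookup m v))"
proof (cases "\<forall>v. r dvd Poly_Mapping.lookup m v")
  case True
  define m' where "m' = Poly_Mapping.map (\<lambda>e. e div r) m"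
  have lk: "Poly_Mapping.lookup m' v = Poly_Mapping.lookup m v div r" for v
    by (simp add: m'_def map.rep_eq when_def)
  have keys: "Poly_Mapping.keys m' = Poly_Mapping.keys m"
    using True assms by (auto simp: in_keys_iff lk dvd_div_eq_0_iff)
  have "pdegree m = r * pdegree m'"
    unfolding pdegree_def keys sum_distrib_left lk
    using True by (intro sum.cong) (auto simp: mult.left_commute)
  then show ?thesis
    using True assms by (simp add: H_block_def subst_powers_def H_def m'_def[symmetric] keys)
next
  case False
  then show ?thesis by (auto simp: H_block_def subst_powers_def)
qed

text \<open>Labeled polywrappings without the rectangles, which \<open>\<gamma>\<close>
  determines.\<close>

definition labeled_types :: "nat \<Rightarrow> nat \<Rightarrow> (otype \<times> (nat \<Rightarrow> nat list)) set"
  where "labeled_types d r = {(\<gamma>, \<Lambda>). \<gamma> \<in> r_OTyp r (d * r) \<and> (\<forall>k. \<Lambda> k \<in> labelings r (\<gamma> k))}"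

definition type_weight :: "nat \<Rightarrow> otype \<Rightarrow> (nat \<Rightarrow> nat list) \<Rightarrow> int"
  where "type_weight r \<gamma> \<Lambda> = (\<Prod>k\<in>supp \<gamma>. labeled_weight r (\<gamma> k) (\<Lambda> k))"

lemma supp_subset:
  assumes "\<gamma> \<in> OTyp N"
  shows "supp \<gamma> \<subseteq> {1..N}"
proof
  fix k assume k: "k \<in> supp \<gamma>"
  have "k * 1 \<le> k * sum_list (\<gamma> k)"
    using k assms composition_sum_pos[of "\<gamma> k"] by (intro mult_le_mono2) (auto simp: OTyp_def supp_def)
  also have "\<dots> \<le> (\<Sum>i\<in>supp \<gamma>. i * sum_list (\<gamma> i))"
    using k assms by (intro member_le_sum) (auto simp: OTyp_def)
  finally have "k \<le> N" using assms by (simp add: OTyp_def)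
  moreover have "k \<noteq> 0"
  proof
    assume "k = 0"
    then show False using k assms by (simp add: OTyp_def supp_def)
  qed
  ultimately show "k \<in> {1..N}" by simp
qed

lemma labelings_Nil: "labelings r [] = {[]}"
  by (auto simp: labelings_def valid_labels_def intro: exI[of _ 0])

lemma labeled_weight_Nil: "labeled_weight r [] [] = shat r []"
  by (simp add: labeled_weight_def label_sums_def)

lemma shat_Nil:
  assumes "r > 0"
  shows "shat r [] = 1"
proof -
  have "{w. length w = r \<and> filter (\<lambda>x. x \<noteq> (0::nat)) w = []} = {replicate r 0}"
    by (auto simp: filter_empty_conv intro!: replicate_eqI)
  moreover have "shat_tuple (replicate r 0) = 1"
    unfolding shat_tuple_eq_chi chi_def by (rule prod.neutral) auto
  ultimately show ?thesis by (simp add: shat_def)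
qed

text \<open>Multiplying out the series for the heights \<open>1, ..., N\<close> picks one labeled
  composition per height; the picks of total weight \<open>N\<close> are the labeled ordered types.
  In an ordered type of \<open>N\<close> heights and areas are at most \<open>N\<close>, so the
  truncations omit none.\<close>

lemma bij_labeled_types:
  fixes d r :: nat
  defines "N \<equiv> d * r"
  defines "X \<equiv> \<lambda>k::nat. SIGMA \<beta>:bounded_comps r N. labelings r \<beta>"
  shows "bij_betw (\<lambda>g. (\<lambda>k. if k \<in> {1..N} then fst (g k) else [], \<lambda>k. if k \<in> {1..N} then snd (g k) else []))
    {g\<in>PiE {1..N} X. (\<Sum>k\<in>{1..N}. k * sum_list (fst (g k))) = N} (labeled_types d r)"
proof (rule bij_betw_byWitness[where f' = "\<lambda>(\<gamma>, \<Lambda>). restrict (\<lambda>k. (\<gamma> k, \<Lambda> k)) {1..N}"], goal_cases)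
  case 1
  show ?case
    by (auto simp: fun_eq_iff restrict_def PiE_def extensional_def)
next
  case 2
  show ?case
  proof
    fix x assume "x \<in> labeled_types d r"
    then obtain \<gamma> \<Lambda> where x: "x = (\<gamma>, \<Lambda>)" "\<gamma> \<in> OTyp N" "\<And>k. \<Lambda> k \<in> labelings r (\<gamma> k)"
      by (auto simp: labeled_types_def r_OTyp_def N_def)
    have "\<gamma> k = []" "\<Lambda> k = []" if "k \<notin> {1..N}" for k
    proof -
      show "\<gamma> k = []" using that supp_subset[OF x(2)] by (auto simp: supp_def)
      then show "\<Lambda> k = []" using x(3)[of k] by (simp add: labelings_Nil)
    qed
    then show "(\<lambda>g. (\<lambda>k. if k \<in> {1..N} then fst (g k) else [], \<lambda>k. if k \<in> {1..N} then snd (g k) else []))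
      ((\<lambda>(\<gamma>, \<Lambda>). restrict (\<lambda>k. (\<gamma> k, \<Lambda> k)) {1..N}) x) = x"
      by (auto simp: x(1) fun_eq_iff)
  qed
next
  case 3
  show ?case
  proof (rule image_subsetI)
    fix g assume g: "g \<in> {g\<in>PiE {1..N} X. (\<Sum>k\<in>{1..N}. k * sum_list (fst (g k))) = N}"
    let ?\<gamma> = "\<lambda>k. if k \<in> {1..N} then fst (g k) else []"
    let ?\<Lambda> = "\<lambda>k. if k \<in> {1..N} then snd (g k) else []"
    have gk: "g k \<in> X k" if "k \<in> {1..N}" for k using g that by auto
    have s: "supp ?\<gamma> \<subseteq> {1..N}" by (auto simp: supp_def)
    then have fin: "finite (supp ?\<gamma>)" by (rule finite_subset) simp
    have "(\<Sum>k\<in>supp ?\<gamma>. k * sum_list (?\<gamma> k)) = (\<Sum>k\<in>{1..N}. k * sum_list (?\<gamma> k))"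
      using s by (intro sum.mono_neutral_left) (auto simp: supp_def)
    also have "\<dots> = N" using g by simp
    finally have "(\<Sum>k\<in>supp ?\<gamma>. k * sum_list (?\<gamma> k)) = N" .
    moreover have "composition (?\<gamma> k)" "r dvd sum_list (?\<gamma> k)" "?\<Lambda> k \<in> labelings r (?\<gamma> k)" for k
      using gk[of k] by (auto simp: X_def bounded_comps_def composition_def[of "[]"] labelings_Nil)
    ultimately show "(?\<gamma>, ?\<Lambda>) \<in> labeled_types d r"
      using fin unfolding labeled_types_def r_OTyp_def OTyp_def N_def[symmetric] by simp
  qed
next
  case 4
  show ?case
  proof (rule image_subsetI)
    fix x assume "x \<in> labeled_types d r"
    then obtain \<gamma> \<Lambda> where x: "x = (\<gamma>, \<Lambda>)" "\<gamma> \<in> OTyp N" "\<And>k. \<Lambda> k \<in> labelings r (\<gamma> k)" "\<And>k. r dvd sum_list (\<gamma> k)"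
      by (auto simp: labeled_types_def r_OTyp_def N_def)
    have s: "supp \<gamma> \<subseteq> {1..N}" using supp_subset[OF x(2)] .
    have total: "(\<Sum>k\<in>{1..N}. k * sum_list (\<gamma> k)) = N"
    proof -
      have "(\<Sum>k\<in>{1..N}. k * sum_list (\<gamma> k)) = (\<Sum>k\<in>supp \<gamma>. k * sum_list (\<gamma> k))"
        using s by (intro sum.mono_neutral_right) (auto simp: supp_def)
      then show ?thesis using x(2) by (simp add: OTyp_def)
    qed
    have "sum_list (\<gamma> k) \<le> N" if "k \<in> {1..N}" for k
    proof -
      have "sum_list (\<gamma> k) \<le> k * sum_list (\<gamma> k)" using that by simp
      also have "\<dots> \<le> (\<Sum>k\<in>{1..N}. k * sum_list (\<gamma> k))" using that by (intro member_le_sum) auto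
      finally show ?thesis using total by simp
    qed
    then have "(\<gamma> k, \<Lambda> k) \<in> X k" if "k \<in> {1..N}" for k
      using x that by (auto simp: X_def bounded_comps_def OTyp_def)
    then show "(\<lambda>(\<gamma>, \<Lambda>). restrict (\<lambda>k. (\<gamma> k, \<Lambda> k)) {1..N}) x \<in>
      {g\<in>PiE {1..N} X. (\<Sum>k\<in>{1..N}. k * sum_list (fst (g k))) = N}"
      using total by (auto simp: x(1))
  qed
qed

lemma finite_labeled_types: "finite (labeled_types d r)"
proof -
  have "finite (PiE {1..d * r} (\<lambda>k::nat. SIGMA \<beta>:bounded_comps r (d * r). labelings r \<beta>))"
    by (intro finite_PiE finite_SigmaI finite_bounded_comps finite_labelings) auto
  then show ?thesis
    using bij_betw_finite[OF bij_labeled_types[of d r]] by simp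
qed

text \<open>The expanded product has terms of many degrees, but each is homogeneous, so at a
  monomial of degree \<open>N\<close> those of other weights drop out. At monomials of other degrees
  both sides are 0.\<close>

lemma H_block_expand:
  assumes "r > 0"
  shows "H_block (d, r) = (\<Sum>(\<gamma>, \<Lambda>)\<in>labeled_types d r. of_int (type_weight r \<gamma> \<Lambda>) * etensor \<gamma>)"
proof (rule mfps_eqI)
  fix m
  define N where "N = d * r"
  define X where "X = (\<lambda>k::nat. SIGMA \<beta>:bounded_comps r N. labelings r \<beta>)"
  define P where "P = (\<lambda>g::nat \<Rightarrow> nat list \<times> nat list. \<Prod>k\<in>{1..N}.
    of_int (labeled_weight r (fst (g k)) (snd (g k))) * prod_list (map (elem_sym k) (fst (g k))))"
  define wt where "wt = (\<lambda>g::nat \<Rightarrow> nat list \<times> nat list. \<Sum>k\<in>{1..N}. k * sum_list (fst (g k)))"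
  let ?F = "\<lambda>g. (\<lambda>k. if k \<in> {1..N} then fst (g k) else [], \<lambda>k. if k \<in> {1..N} then snd (g k) else [])"
  have finX: "finite (X k)" for k
    unfolding X_def by (intro finite_SigmaI finite_bounded_comps finite_labelings)
  then have finG: "finite (PiE {1..N} X)" by (intro finite_PiE) auto
  have P_eq: "of_int (type_weight r (fst (?F g)) (snd (?F g))) * etensor (fst (?F g)) = P g"
    if g: "g \<in> PiE {1..N} X" for g
  proof -
    let ?\<gamma> = "fst (?F g)" and ?\<Lambda> = "snd (?F g)"
    have s: "supp ?\<gamma> \<subseteq> {1..N}" by (auto simp: supp_def)
    \<comment> \<open>A height outside the support has the empty labeling and the factor
      \<open>shat r [] = 1\<close>, so both products may run over all heights up to
      \<open>N\<close>.\<close>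
    have Nil: "?\<gamma> k = []" "labeled_weight r (?\<gamma> k) (?\<Lambda> k) = 1" if k: "k \<in> {1..N} - supp ?\<gamma>" for k
    proof -
      show "?\<gamma> k = []" using k by (auto simp: supp_def)
      moreover have "g k \<in> X k" using PiE_mem[OF g, of k] k by blast
      then have "?\<Lambda> k \<in> labelings r (?\<gamma> k)"
        using k by (cases "g k") (simp add: X_def)
      ultimately show "labeled_weight r (?\<gamma> k) (?\<Lambda> k) = 1"
        using labeled_weight_Nil shat_Nil[OF assms] by (simp only: labelings_Nil singleton_iff)
    qed
    have "type_weight r ?\<gamma> ?\<Lambda> = (\<Prod>k\<in>{1..N}. labeled_weight r (?\<gamma> k) (?\<Lambda> k))"
      unfolding type_weight_def using s Nil(2) by (intro prod.mono_neutral_left) auto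
    moreover have "etensor ?\<gamma> = (\<Prod>k\<in>{1..N}. prod_list (map (elem_sym k) (?\<gamma> k)))"
      unfolding etensor_def using s Nil(1) by (intro prod.mono_neutral_left) auto
    ultimately show ?thesis by (simp add: P_def prod.distrib)
  qed
  have homP: "homogeneous (wt g) (P g)" for g
  proof -
    have "P g = of_int (\<Prod>k\<in>{1..N}. labeled_weight r (fst (g k)) (snd (g k))) *
        (\<Prod>k\<in>{1..N}. prod_list (map (elem_sym k) (fst (g k))))"
      by (simp add: P_def prod.distrib)
    moreover have "homogeneous (wt g) (\<Prod>k\<in>{1..N}. prod_list (map (elem_sym k) (fst (g k))))"
      unfolding wt_def by (intro homogeneous_prod homogeneous_prod_elem_sym)
    ultimately show ?thesis by (simp only: homogeneous_of_int_mult)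
  qed
  have "(\<Sum>(\<gamma>, \<Lambda>)\<in>labeled_types d r. of_int (type_weight r \<gamma> \<Lambda>) * etensor \<gamma>) =
    (\<Sum>g\<in>{g\<in>PiE {1..N} X. wt g = N}. P g)"
    unfolding sum.reindex_bij_betw[OF bij_labeled_types[of d r], symmetric]
    by (rule sum.cong) (use P_eq in \<open>auto simp: N_def X_def wt_def\<close>)
  then have "mfps_nth (\<Sum>(\<gamma>, \<Lambda>)\<in>labeled_types d r. of_int (type_weight r \<gamma> \<Lambda>) * etensor \<gamma>) m =
    (\<Sum>g\<in>{g\<in>PiE {1..N} X. wt g = N}. mfps_nth (P g) m)"
    by (simp only: nth_sum)
  also have "\<dots> = mfps_nth (H_block (d, r)) m"
  proof (cases "pdegree m = N")
    case True
    have "(\<Sum>g\<in>{g\<in>PiE {1..N} X. wt g = N}. mfps_nth (P g) m) = (\<Sum>g\<in>PiE {1..N} X. mfps_nth (P g) m)"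
      using finG homP True by (intro sum.mono_neutral_left) (auto simp: homogeneous_def)
    also have "\<dots> = mfps_nth (\<Prod>k\<in>{1..N}. power_series r N k) m"
      unfolding power_series_def P_def nth_sum[symmetric] X_def[symmetric]
      by (subst prod_sum_PiE) (use finX in \<open>auto simp: X_def case_prod_beta\<close>)
    also have "\<dots> = mfps_nth (H_block (d, r)) m"
      using nth_prod_power_series[OF assms True] nth_H_block[OF assms, of d m] True by (simp add: N_def)
    finally show ?thesis .
  next
    case False
    then have "(\<Sum>g\<in>{g\<in>PiE {1..N} X. wt g = N}. mfps_nth (P g) m) = 0"
      using homP by (intro sum.neutral) (auto simp: homogeneous_def)
    then show ?thesis
      using False nth_H_block[OF assms, of d m] by (simp add: N_def)
  qed
  finally show "mfps_nth (H_block (d, r)) m =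
    mfps_nth (\<Sum>(\<gamma>, \<Lambda>)\<in>labeled_types d r. of_int (type_weight r \<gamma> \<Lambda>) * etensor \<gamma>) m" ..
qed

section \<open>Labeled polywrappings\<close>

lemma length_chop: "length (chop \<beta> xs) = length \<beta>"
  by (induction \<beta> xs rule: chop.induct) auto

lemma nth_chop:
  "j < length \<beta> \<Longrightarrow> chop \<beta> xs ! j = take (\<beta> ! j) (drop (sum_list (take j \<beta>)) xs)"
proof (induction \<beta> xs arbitrary: j rule: chop.induct)
  case (2 b bs xs)
  then show ?case by (cases j) (auto simp: add.commute)
qed simp

definition sheet_column :: "nat \<Rightarrow> nat \<Rightarrow> nat \<times> nat \<Rightarrow> box set"
  where "sheet_column a k = (\<lambda>(s, c). {a + s * k ..< a + Suc s * k} \<times> {c})"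

lemma sheet_columns_eq:
  "sheet_columns a N r k = map (sheet_column a k) (List.product [0..<N div k] [0..<r])"
  by (simp add: sheet_columns_def sheet_column_def product_concat_map map_concat o_def)

lemma card_sheet_column: "card (sheet_column a k p) = k"
  by (cases p) (simp add: sheet_column_def card_cartesian_product)

lemma sheet_column_disjoint:
  assumes "p \<noteq> q"
  shows "sheet_column a k p \<inter> sheet_column a k q = {}"
proof -
  obtain s c s' c' where pq: "p = (s, c)" "q = (s', c')" by (cases p, cases q)
  show ?thesis
  proof (cases "c = c'")
    case True
    then have "Suc s \<le> s' \<or> Suc s' \<le> s" using assms pq by auto
    then have "Suc s * k \<le> s' * k \<or> Suc s' * k \<le> s * k" using mult_le_mono1 by blast
    then show ?thesis by (auto simp: pq sheet_column_def)
  qed (auto simp: pq sheet_column_def)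
qed

text \<open>As \<open>r\<close> divides the area, the group of rows has exactly
  \<open>sum_list \<beta>\<close> sheet columns and chopping never runs out of them. The columns are
  disjoint and have \<open>k\<close> boxes each.\<close>

lemma card_wrapping:
  assumes "k > 0" "r > 0" "r dvd sum_list \<beta>" "N = k * (sum_list \<beta> div r)" "j < length \<beta>"
  shows "card (wrapping a N r k \<beta> ! j) = k * \<beta> ! j"
proof -
  let ?P = "List.product [0..<N div k] [0..<r]"
  define ps where "ps = take (\<beta> ! j) (drop (sum_list (take j \<beta>)) ?P)"
  have "length ?P = sum_list \<beta>"
    using assms(1,3,4) by (simp add: length_product)
  moreover have "sum_list \<beta> = sum_list (take j \<beta>) + \<beta> ! j + sum_list (drop (Suc j) \<beta>)"
    using assms(5) by (subst id_take_nth_drop[of j \<beta>]) auto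
  ultimately have len: "length ps = \<beta> ! j"
    by (simp add: ps_def)
  have dist: "distinct ps"
    unfolding ps_def by (intro distinct_take distinct_drop distinct_product) auto
  have "wrapping a N r k \<beta> ! j = \<Union> (set (map (sheet_column a k) ps))"
    using assms(5) by (simp add: wrapping_def length_chop nth_chop sheet_columns_eq ps_def take_map drop_map)
  also have "card \<dots> = (\<Sum>p\<in>set ps. card (sheet_column a k p))"
    unfolding set_map
    by (intro card_UN_disjoint) (auto simp: sheet_column_disjoint, auto simp: sheet_column_def)
  also have "\<dots> = k * \<beta> ! j"
    using len dist by (simp add: card_sheet_column distinct_card)
  finally show ?thesis .
qed

lemma length_polywrapping: "length (polywrapping r \<gamma> k) = length (\<gamma> k)"
  by (simp add: polywrapping_def wrapping_def length_chop)

definition make_lpw :: "nat \<Rightarrow> otype \<times> (nat \<Rightarrow> nat list) \<Rightarrow> lpw"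
  where "make_lpw r = (\<lambda>(\<gamma>, \<Lambda>). \<lparr>pocon = \<gamma>, rects = polywrapping r \<gamma>, labels = \<Lambda>\<rparr>)"

lemma bij_make_lpw: "bij_betw (make_lpw r) (labeled_types d r) (labeled_polywrappings (d, r))"
proof (rule bij_betw_byWitness[where f' = "\<lambda>D. (pocon D, labels D)"])
  show "make_lpw r ` labeled_types d r \<subseteq> labeled_polywrappings (d, r)"
    by (auto simp: make_lpw_def labeled_types_def labeled_polywrappings_def labelings_def length_polywrapping)
  show "(\<lambda>D. (pocon D, labels D)) ` labeled_polywrappings (d, r) \<subseteq> labeled_types d r"
    by (auto simp: labeled_types_def labeled_polywrappings_def labelings_def length_polywrapping)
qed (auto simp: make_lpw_def labeled_polywrappings_def)

text \<open>The box count of a rectangle is the height times its part, so dividing by the height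
  returns the part exactly.\<close>

lemma label_otype_make_lpw:
  assumes "r > 0" "(\<gamma>, \<Lambda>) \<in> labeled_types d r"
  shows "label_otype (make_lpw r (\<gamma>, \<Lambda>)) = (\<lambda>k. label_sums (\<gamma> k) (\<Lambda> k))"
proof
  fix k
  have \<gamma>: "\<gamma> 0 = []" "r dvd sum_list (\<gamma> k)" and \<Lambda>: "\<Lambda> k \<in> labelings r (\<gamma> k)"
    using assms(2) by (auto simp: labeled_types_def r_OTyp_def OTyp_def)
  have len: "length (\<Lambda> k) = length (\<gamma> k)" using \<Lambda> by (simp add: labelings_def)
  show "label_otype (make_lpw r (\<gamma>, \<Lambda>)) k = label_sums (\<gamma> k) (\<Lambda> k)"
  proof (cases "k = 0")
    case True
    then have "\<Lambda> k = []" using \<Lambda> \<gamma>(1) by (simp add: labelings_Nil)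
    then show ?thesis by (simp add: label_otype_def make_lpw_def label_sums_def)
  next
    case False
    have "(\<Sum>j | j < length (\<Lambda> k) \<and> \<Lambda> k ! j = i. card (polywrapping r \<gamma> k ! j)) =
      k * (\<Sum>j | j < length (\<Lambda> k) \<and> \<Lambda> k ! j = i. \<gamma> k ! j)" for i
      unfolding sum_distrib_left polywrapping_def
      by (rule sum.cong) (use False \<gamma> assms(1) len in \<open>auto simp: group_rows_def intro!: card_wrapping\<close>)
    then show ?thesis
      using False by (simp add: label_otype_def make_lpw_def label_sums_def)
  qed
qed

text \<open>Everything factors over the heights: the label type has the same support as
  \<open>\<gamma>\<close>, and area minus length is a sum of differences of which none is
  truncated.\<close>

lemma psgn_make_lpw:
  assumes "r > 0" "(\<gamma>, \<Lambda>) \<in> labeled_types d r"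
  shows "psgn_lpw (d, r) (make_lpw r (\<gamma>, \<Lambda>)) = type_weight r \<gamma> \<Lambda>"
proof -
  have \<gamma>: "finite (supp \<gamma>)" "\<And>k. composition (\<gamma> k)" and \<Lambda>: "\<And>k. \<Lambda> k \<in> labelings r (\<gamma> k)"
    using assms(2) by (auto simp: labeled_types_def r_OTyp_def OTyp_def)
  have supp: "supp (\<lambda>k. label_sums (\<gamma> k) (\<Lambda> k)) = supp \<gamma>"
  proof -
    have "length (\<Lambda> k) = length (\<gamma> k)" for k using \<Lambda> by (simp add: labelings_def)
    then have "\<Lambda> k = [] \<longleftrightarrow> \<gamma> k = []" for k by (metis length_0_conv)
    moreover have "label_sums (\<gamma> k) (\<Lambda> k) = [] \<longleftrightarrow> \<Lambda> k = []" for k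
      by (auto simp: label_sums_def card_gt_0_iff Suc_le_eq)
    ultimately show ?thesis by (simp add: supp_def)
  qed
  have "(\<Sum>k\<in>supp \<gamma>. sum_list (\<gamma> k)) - (\<Sum>k\<in>supp \<gamma>. length (\<gamma> k)) =
      (\<Sum>k\<in>supp \<gamma>. sum_list (\<gamma> k) - length (\<gamma> k))"
    by (rule sum_subtractf_nat[symmetric]) (use \<gamma>(2) length_le_sum_list in blast)
  then have "oarea \<gamma> - olength \<gamma> = (\<Sum>k\<in>supp \<gamma>. sum_list (\<gamma> k) - length (\<gamma> k))"
    by (simp add: oarea_def olength_def)
  then have "psgn_lpw (d, r) (make_lpw r (\<gamma>, \<Lambda>)) =
      (\<Prod>k\<in>supp \<gamma>. (- 1) ^ (sum_list (\<gamma> k) - length (\<gamma> k))) * (\<Prod>k\<in>supp \<gamma>. shat r (label_sums (\<gamma> k) (\<Lambda> k)))"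
    using label_otype_make_lpw[OF assms] supp
    by (simp add: psgn_lpw_def shat_otype_def power_sum make_lpw_def)
  then show ?thesis
    by (simp add: type_weight_def labeled_weight_def prod.distrib)
qed

lemma finite_labeled_polywrappings: "finite (labeled_polywrappings b)"
  using bij_betw_finite[OF bij_make_lpw[of "snd b" "fst b"]] finite_labeled_types by simp

lemma H_block_eq_sum_labeled_polywrappings:
  assumes "snd b > 0"
  shows "H_block b = (\<Sum>D\<in>labeled_polywrappings b. of_int (psgn_lpw b D) * etensor (pocon D))"
proof -
  obtain d r where b: "b = (d, r)" by (cases b)
  have "(\<Sum>D\<in>labeled_polywrappings b. of_int (psgn_lpw b D) * etensor (pocon D)) =
    (\<Sum>x\<in>labeled_types d r. of_int (psgn_lpw b (make_lpw r x)) * etensor (pocon (make_lpw r x)))"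
    unfolding b by (rule sum.reindex_bij_betw[OF bij_make_lpw, symmetric])
  also have "\<dots> = (\<Sum>(\<gamma>, \<Lambda>)\<in>labeled_types d r. of_int (type_weight r \<gamma> \<Lambda>) * etensor \<gamma>)"
  proof (rule sum.cong)
    fix x assume x: "x \<in> labeled_types d r"
    obtain \<gamma> \<Lambda> where "x = (\<gamma>, \<Lambda>)" by (cases x)
    moreover have "pocon (make_lpw r (\<gamma>, \<Lambda>)) = \<gamma>" by (simp add: make_lpw_def)
    ultimately show "of_int (psgn_lpw b (make_lpw r x)) * etensor (pocon (make_lpw r x)) =
        (case x of (\<gamma>, \<Lambda>) \<Rightarrow> of_int (type_weight r \<gamma> \<Lambda>) * etensor \<gamma>)"
      using x psgn_make_lpw[of r \<gamma> \<Lambda> d] assms by (simp add: b)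
  qed simp
  also have "\<dots> = H_block b"
    using assms by (simp add: b H_block_expand)
  finally show ?thesis ..
qed

section \<open>Linear independence\<close>

text \<open>Here \<open>\<le>\<close> is lexicographic on exponents: the least variable at which two
  monomials differ decides, and variables are themselves ordered lexicographically as pairs. Leading
  coefficient 1 is preserved by products.\<close>

definition leading_monomial :: "pseries \<Rightarrow> (nat \<times> nat \<Rightarrow>\<^sub>0 nat) \<Rightarrow> bool"
  where "leading_monomial f m \<longleftrightarrow> mfps_nth f m = 1 \<and> (\<forall>m'. mfps_nth f m' \<noteq> 0 \<longrightarrow> m' \<le> m)"

lemma leading_monomial_1: "leading_monomial 1 0"
  by (auto simp: leading_monomial_def one_mfps.rep_eq split: if_splits)

text \<open>The order is strictly compatible with addition of monomials, so \<open>a + b\<close>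
  arises from no other pair of occurring monomials.\<close>

lemma leading_monomial_mult:
  assumes "leading_monomial f a" "leading_monomial g b"
  shows "leading_monomial (f * g) (a + b)"
  unfolding leading_monomial_def
proof (intro conjI allI impI)
  have "mfps_nth (f * g) (a + b) = (\<Sum>x\<in>{(p, q). p + q = a + b}. if x = (a, b) then 1 else 0)"
    unfolding times_mfps.rep_eq
  proof (rule sum.cong)
    fix x assume "x \<in> {(p, q). p + q = a + b}"
    then obtain p q where x: "x = (p, q)" "p + q = a + b" by auto
    have *: "(p, q) = (a, b)" if "mfps_nth f p \<noteq> 0" "mfps_nth g q \<noteq> 0"
    proof -
      have le: "p \<le> a" "q \<le> b" using that assms by (auto simp: leading_monomial_def)
      have "p = a"
      proof (rule ccontr)
        assume "p \<noteq> a"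
        then have "p + q < a + b" using le by (intro add_less_le_mono) auto
        then show False using x(2) by simp
      qed
      then show ?thesis using x(2) by simp
    qed
    then show "(case x of (p, q) \<Rightarrow> mfps_nth f p * mfps_nth g q) = (if x = (a, b) then 1 else 0)"
    proof (cases "(p, q) = (a, b)")
      case True
      then show ?thesis using assms by (simp add: x(1) leading_monomial_def)
    next
      case False
      then have "mfps_nth f p * mfps_nth g q = 0" using * by (metis mult_eq_0_iff)
      then show ?thesis using False by (auto simp: x(1))
    qed
  qed simp
  then show "mfps_nth (f * g) (a + b) = 1"
    by (simp only: sum.delta[OF finite_monomial_summands]) simp
next
  fix m assume "mfps_nth (f * g) m \<noteq> 0"
  then obtain x where "x \<in> {(p, q). p + q = m}" "(case x of (p, q) \<Rightarrow> mfps_nth f p * mfps_nth g q) \<noteq> 0"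
    unfolding times_mfps.rep_eq by (rule sum.not_neutral_contains_not_neutral)
  then obtain p q where "p + q = m" "mfps_nth f p \<noteq> 0" "mfps_nth g q \<noteq> 0"
    by (cases x) auto
  then show "m \<le> a + b"
    using assms by (auto simp: leading_monomial_def intro: add_mono)
qed

lemma leading_monomial_prod:
  "(\<And>i. i \<in> I \<Longrightarrow> leading_monomial (f i) (m i)) \<Longrightarrow> leading_monomial (prod f I) (sum m I)"
  by (induction I rule: infinite_finite_induct) (auto intro: leading_monomial_1 leading_monomial_mult)

lemma leading_monomial_prod_list:
  "(\<And>x. x \<in> set xs \<Longrightarrow> leading_monomial (f x) (m x)) \<Longrightarrow>
    leading_monomial (prod_list (map f xs)) (sum_list (map m xs))"
  by (induction xs) (auto intro: leading_monomial_1 leading_monomial_mult)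

text \<open>Any other monomial of \<open>elem_sym i k\<close> misses some \<open>(i, l)\<close> with
  \<open>1 \<le> l \<le> k\<close>. Before the first such variable it agrees with the candidate, and
  there it has the smaller exponent.\<close>

lemma leading_monomial_elem_sym: "leading_monomial (elem_sym i k) (set_monomial ({i} \<times> {1..k}))"
  unfolding leading_monomial_def
proof (intro conjI allI impI)
  let ?L = "{i} \<times> {1..k}"
  show "mfps_nth (elem_sym i k) (set_monomial ?L) = 1"
    by (auto simp: nth_elem_sym squarefree_set_monomial mdeg_squarefree keys_set_monomial card_cartesian_product)
  fix m assume "mfps_nth (elem_sym i k) m \<noteq> 0"
  then have m: "Poly_Mapping.keys m \<subseteq> {i} \<times> {1..}" "squarefree_monomial m" "mdeg m = k"
    by (auto simp: nth_elem_sym)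
  let ?A = "Poly_Mapping.keys m"
  show "m \<le> set_monomial ?L"
  proof (cases "?L \<subseteq> ?A")
    case True
    moreover have "card ?A = card ?L"
      using m by (simp add: mdeg_squarefree card_cartesian_product)
    ultimately have "?L = ?A" by (intro card_subset_eq) auto
    then show ?thesis using set_monomial_keys[OF m(2)] by simp
  next
    case False
    define l where "l = (LEAST j. j \<in> {1..k} \<and> (i, j) \<notin> ?A)"
    have ex: "\<exists>j. j \<in> {1..k} \<and> (i, j) \<notin> ?A" using False by auto
    have l: "l \<in> {1..k}" "(i, l) \<notin> ?A"
      using LeastI_ex[OF ex] by (auto simp: l_def)
    have least: "(i, j) \<in> ?A" if "j \<in> {1..k}" "j < l" for j
      using not_less_Least[of j] that unfolding l_def by blast
    have lkm: "Poly_Mapping.lookup m v = of_bool (v \<in> ?A)" for v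
      using m(2) by (auto simp: squarefree_monomial_def in_keys_iff)
    have "v \<in> ?A \<longleftrightarrow> v \<in> ?L" if v: "v < (i, l)" for v
    proof (cases "fst v = i")
      case True
      then obtain j where j: "v = (i, j)" "j < l" using v by (cases v) (auto simp: less_prod_def)
      show ?thesis
      proof (cases "j = 0")
        case True
        then show ?thesis using m(1) j by auto
      next
        case False
        then show ?thesis using least[of j] j l by auto
      qed
    next
      case False
      then have "v \<notin> ?A" "v \<notin> ?L" using m(1) by auto
      then show ?thesis by blast
    qed
    then have "m < set_monomial ?L"
      unfolding less_poly_mapping.rep_eq less_fun_def
      using l by (intro exI[of _ "(i, l)"]) (simp add: lkm lookup_set_monomial)
    then show ?thesis by simp
  qed
qed

text \<open>For a type, the exponents of \<open>x_i1, x_i2, ...\<close> form the partition conjugate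
  to \<open>\<tau> i\<close>.\<close>

definition type_monomial :: "otype \<Rightarrow> nat \<times> nat \<Rightarrow>\<^sub>0 nat"
  where "type_monomial \<tau> = (\<Sum>i\<in>supp \<tau>. \<Sum>k\<leftarrow>\<tau> i. set_monomial ({i} \<times> {1..k}))"

lemma leading_monomial_etensor: "leading_monomial (etensor \<tau>) (type_monomial \<tau>)"
  unfolding etensor_def type_monomial_def
  by (intro leading_monomial_prod leading_monomial_prod_list leading_monomial_elem_sym)

lemma lookup_type_monomial:
  assumes "finite (supp \<tau>)" "j \<ge> 1"
  shows "Poly_Mapping.lookup (type_monomial \<tau>) (i, j) = length (filter (\<lambda>k. j \<le> k) (\<tau> i))"
proof -
  have *: "Poly_Mapping.lookup (\<Sum>k\<leftarrow>\<beta>. set_monomial ({i'} \<times> {1..k})) (i, j) =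
      (if i' = i then length (filter (\<lambda>k. j \<le> k) \<beta>) else 0)" for i' \<beta>
    using assms(2) by (induction \<beta>) (auto simp: lookup_add lookup_set_monomial)
  have "Poly_Mapping.lookup (type_monomial \<tau>) (i, j) =
      (\<Sum>i'\<in>supp \<tau>. if i' = i then length (filter (\<lambda>k. j \<le> k) (\<tau> i)) else 0)"
    unfolding type_monomial_def lookup_sum * by (rule sum.cong) auto
  also have "\<dots> = length (filter (\<lambda>k. j \<le> k) (\<tau> i))"
    using assms(1) by (auto simp: supp_def)
  finally show ?thesis .
qed

lemma type_eqI:
  assumes "\<rho> \<in> Typ n" "\<tau> \<in> Typ n" "\<And>i. mset (\<rho> i) = mset (\<tau> i)"
  shows "\<rho> = \<tau>"
proof
  fix i
  have "sorted (rev (\<rho> i))" "sorted (rev (\<tau> i))"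
    using assms(1,2) by (auto simp: Typ_def sorted_wrt_rev)
  then have "rev (\<rho> i) = rev (\<tau> i)"
    using properties_for_sort[of "rev (\<rho> i)" "\<rho> i"] properties_for_sort[of "rev (\<tau> i)" "\<tau> i"]
      sorted_list_of_multiset_mset[of "\<rho> i"] sorted_list_of_multiset_mset[of "\<tau> i"] assms(3)[of i]
    by (metis mset_rev)
  then show "\<rho> i = \<tau> i" by simp
qed

text \<open>Multiplicities of parts determine a type, and the multiplicity of
  \<open>k \<ge> 1\<close> is the drop from the exponent of \<open>x_ik\<close> to that of the next
  variable.\<close>

lemma inj_on_type_monomial: "inj_on type_monomial (Typ n)"
proof (rule inj_onI)
  fix \<rho> \<tau> assume \<rho>: "\<rho> \<in> Typ n" and \<tau>: "\<tau> \<in> Typ n" and eq: "type_monomial \<rho> = type_monomial \<tau>"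
  have fin: "finite (supp \<rho>)" "finite (supp \<tau>)" using \<rho> \<tau> by (auto simp: Typ_def OTyp_def)
  have len: "length (filter (\<lambda>k. j \<le> k) (\<rho> i)) = length (filter (\<lambda>k. j \<le> k) (\<tau> i))" if "j \<ge> 1" for i j
    using lookup_type_monomial[OF fin(1) that, of i] lookup_type_monomial[OF fin(2) that, of i] eq by simp
  have cnt: "count (mset \<beta>) k + length (filter (\<lambda>x. Suc k \<le> x) \<beta>) = length (filter (\<lambda>x. k \<le> x) \<beta>)" for \<beta> k
    by (induction \<beta>) auto
  show "\<rho> = \<tau>"
  proof (rule type_eqI[OF \<rho> \<tau>], rule multiset_eqI)
    fix i k
    show "count (mset (\<rho> i)) k = count (mset (\<tau> i)) k"
    proof (cases "k = 0")
      case True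
      have "0 \<notin> set (\<rho> i)" "0 \<notin> set (\<tau> i)" using \<rho> \<tau> by (auto simp: Typ_def OTyp_def composition_def)
      then show ?thesis using True by (metis count_eq_zero_iff set_mset_mset)
    next
      case False
      then show ?thesis using cnt[of "\<rho> i" k] cnt[of "\<tau> i" k] len[of k i] len[of "Suc k" i] by simp
    qed
  qed
qed

text \<open>Among the terms with nonzero scalar in a vanishing combination, take the one with the
  largest leading monomial. No other of these terms contains that monomial, so its coefficient in
  the sum is a nonzero scalar.\<close>

lemma
  assumes lead: "\<And>i. i \<in> I \<Longrightarrow> leading_monomial (F i) (m i)" and inj: "inj_on m I"
  shows inj_on_of_leading_monomials: "inj_on F I"
    and independent_of_leading_monomials: "pseries.independent (F ` I)"
proof -
  have eq: "m i = m j" if "i \<in> I" "j \<in> I" "F i = F j" for i j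
  proof (rule antisym)
    show "m i \<le> m j" "m j \<le> m i"
      using lead[OF that(1)] lead[OF that(2)] that(3) by (simp_all add: leading_monomial_def)
  qed
  show injF: "inj_on F I"
    by (rule inj_onI) (rule inj_onD[OF inj eq])
  show "pseries.independent (F ` I)"
  proof
    assume "pseries.dependent (F ` I)"
    then obtain T u f where T: "finite T" "T \<subseteq> F ` I" "(\<Sum>v\<in>T. mfps_scale (u v) v) = 0"
      and f: "f \<in> T" "u f \<noteq> 0"
      unfolding pseries.dependent_explicit by blast
    define J where "J = {i\<in>I. F i \<in> T \<and> u (F i) \<noteq> 0}"
    have FJ: "F ` J = {v\<in>T. u v \<noteq> 0}" using T(2) unfolding J_def by blast
    have injJ: "inj_on F J" using injF by (rule inj_on_subset) (auto simp: J_def)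
    have "finite J"
      using finite_imageD[OF _ injJ] FJ T(1) by simp
    moreover have "J \<noteq> {}" using f FJ by auto
    ultimately have "Max (m ` J) \<in> m ` J" "\<And>j. j \<in> J \<Longrightarrow> m j \<le> Max (m ` J)"
      by (simp_all del: image_iff)
    then obtain i where i: "i \<in> J" "\<And>j. j \<in> J \<Longrightarrow> m j \<le> m i"
      by (metis imageE)
    have iI: "i \<in> I" "u (F i) \<noteq> 0" "F i \<in> T" using i by (auto simp: J_def)
    have "0 = mfps_nth (\<Sum>v\<in>T. mfps_scale (u v) v) (m i)"
      by (simp add: T(3) zero_mfps.rep_eq)
    also have "\<dots> = (\<Sum>v\<in>T. u v * mfps_nth v (m i))"
      by (simp add: nth_sum mfps_scale.rep_eq)
    also have "\<dots> = (\<Sum>v\<in>T. if v = F i then u (F i) else 0)"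
    proof (rule sum.cong)
      fix v assume v: "v \<in> T"
      show "u v * mfps_nth v (m i) = (if v = F i then u (F i) else 0)"
      proof (cases "v = F i")
        case True
        then show ?thesis using lead[OF iI(1)] by (simp add: leading_monomial_def)
      next
        case False
        have "mfps_nth v (m i) = 0" if uv: "u v \<noteq> 0"
        proof (rule ccontr)
          assume nz: "mfps_nth v (m i) \<noteq> 0"
          obtain j where j: "j \<in> I" "v = F j" using v T(2) by auto
          then have "j \<in> J" using uv v by (simp add: J_def)
          then have "m j \<le> m i" by (rule i(2))
          moreover have "m i \<le> m j" using lead[OF j(1)] nz j(2) by (simp add: leading_monomial_def)
          ultimately have "m i = m j" by (rule antisym[rotated])
          then have "i = j" using inj iI(1) j(1) by (auto dest: inj_onD)
          then show False using False j(2) by simp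
        qed
        then show ?thesis using False by auto
      qed
    qed simp
    also have "\<dots> = u (F i)" using T(1) iI(3) by simp
    finally show False using iI(2) by simp
  qed
qed

lemma inj_on_etensor: "inj_on etensor (Typ n)"
  by (rule inj_on_of_leading_monomials[OF leading_monomial_etensor inj_on_type_monomial])

lemma independent_etensor: "pseries.independent (etensor ` Typ n)"
  by (rule independent_of_leading_monomials[OF leading_monomial_etensor inj_on_type_monomial])

section \<open>Tabloids\<close>

lemma count_image_Pair:
  "count (image_mset (Pair a) N) (d, r) = (if a = d then count N r else 0)"
  by (induction N) auto

lemma count_blocks:
  assumes "finite (supp \<tau>)"
  shows "count (blocks \<tau>) (d, r) = count (mset (\<tau> d)) r"
proof -
  have "count (blocks \<tau>) (d, r) = (\<Sum>a\<in>supp \<tau>. if a = d then count (mset (\<tau> d)) r else 0)"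
    unfolding blocks_def count_sum count_image_Pair by (rule sum.cong) auto
  then show ?thesis using assms by (auto simp: supp_def)
qed

lemma blocks_psort: "blocks (psort \<delta>) = blocks \<delta>"
proof -
  have "supp (psort \<delta>) = supp \<delta>"
  proof -
    have "sort xs = [] \<longleftrightarrow> xs = []" for xs :: "nat list"
      by (metis length_0_conv length_sort)
    then show ?thesis by (simp add: supp_def psort_def)
  qed
  then show ?thesis by (simp add: blocks_def psort_def)
qed

lemma inj_on_blocks: "inj_on blocks (Typ n)"
proof (rule inj_onI)
  fix \<rho> \<tau> assume *: "\<rho> \<in> Typ n" "\<tau> \<in> Typ n" "blocks \<rho> = blocks \<tau>"
  then have fin: "finite (supp \<rho>)" "finite (supp \<tau>)" by (auto simp: Typ_def OTyp_def)
  show "\<rho> = \<tau>"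
  proof (rule type_eqI[OF *(1,2)], rule multiset_eqI)
    fix d r
    show "count (mset (\<rho> d)) r = count (mset (\<tau> d)) r"
      using count_blocks[OF fin(1), of d r] count_blocks[OF fin(2), of d r] *(3) by simp
  qed
qed

lemma prod_mset_sum:
  "(\<Prod>b\<in>#(\<Sum>d\<in>S. M d). f b) = (\<Prod>d\<in>S. \<Prod>b\<in>#M d. f b)"
  by (induction S rule: infinite_finite_induct) auto

lemma sum_mset_sum:
  "(\<Sum>b\<in>#(\<Sum>d\<in>S. M d). f b) = (\<Sum>d\<in>S. \<Sum>b\<in>#M d. f b)"
  by (induction S rule: infinite_finite_induct) auto

text \<open>Multiplying such series adds block multisets; this is why the product over the entries
  of a tabloid depends only on its content.\<close>

lemma etensor_eq_prod_blocks: "etensor \<delta> = (\<Prod>(d, r)\<in>#blocks \<delta>. elem_sym d r)"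
proof -
  have "prod_list (map (elem_sym d) \<beta>) = (\<Prod>b\<in>#image_mset (Pair d) (mset \<beta>). case b of (d, r) \<Rightarrow> elem_sym d r)" for d \<beta>
    by (induction \<beta>) auto
  then show ?thesis
    unfolding etensor_def blocks_def prod_mset_sum by simp
qed

lemma sum_blocks: "(\<Sum>(d, r)\<in>#blocks \<delta>. d * r) = (\<Sum>d\<in>supp \<delta>. d * sum_list (\<delta> d))"
proof -
  have "d * sum_list \<beta> = (\<Sum>b\<in>#image_mset (Pair d) (mset \<beta>). case b of (d, r) \<Rightarrow> d * r)" for d :: nat and \<beta>
    by (induction \<beta>) (auto simp: distrib_left)
  then show ?thesis
    unfolding blocks_def sum_mset_sum by simp
qed

lemma blocks_pos:
  assumes "\<delta> \<in> OTyp n" "(d, r) \<in># blocks \<delta>"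
  shows "d > 0" "r > 0"
proof -
  have "finite (supp \<delta>)" using assms(1) by (simp add: OTyp_def)
  then have "r \<in> set (\<delta> d)"
    using count_blocks[of \<delta> d r] assms(2) by (metis not_in_iff set_mset_mset)
  moreover have "\<delta> 0 = []" "composition (\<delta> d)" using assms(1) by (auto simp: OTyp_def)
  ultimately show "d > 0" "r > 0"
    by (auto simp: composition_def intro!: gr0I)
qed

text \<open>Turns the content of a tabloid, so far only a multiset of blocks, into a type of
  \<open>n\<close>, so that the corresponding product is a basis element.\<close>

lemma exists_type_of_blocks:
  fixes M :: "(nat \<times> nat) multiset"
  assumes "\<And>d r. (d, r) \<in># M \<Longrightarrow> d > 0 \<and> r > 0" "(\<Sum>(d, r)\<in>#M. d * r) = n"
  shows "\<exists>\<tau>\<in>Typ n. blocks \<tau> = M"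
proof -
  define \<tau> where "\<tau> = (\<lambda>d. rev (sorted_list_of_multiset (image_mset snd (filter_mset (\<lambda>b. fst b = d) M))))"
  have mset: "mset (\<tau> d) = image_mset snd (filter_mset (\<lambda>b. fst b = d) M)" for d
    by (simp add: \<tau>_def)
  have set: "r \<in> set (\<tau> d) \<longleftrightarrow> (d, r) \<in># M" for d r
    unfolding set_mset_mset[symmetric] mset by (force simp: image_iff)
  have "supp \<tau> \<subseteq> fst ` set_mset M"
  proof
    fix d assume "d \<in> supp \<tau>"
    then obtain r where "r \<in> set (\<tau> d)" by (cases "\<tau> d") (auto simp: supp_def)
    then show "d \<in> fst ` set_mset M" using set by force
  qed
  then have fin: "finite (supp \<tau>)" by (rule finite_subset) simp
  have blocks: "blocks \<tau> = M"
  proof (rule multiset_eqI)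
    fix b :: "nat \<times> nat"
    obtain d r where b: "b = (d, r)" by (cases b)
    have "count (image_mset snd (filter_mset (\<lambda>b. fst b = d) M)) r = count M (d, r)"
      by (induction M) auto
    then show "count (blocks \<tau>) b = count M b"
      unfolding b count_blocks[OF fin] mset .
  qed
  have "\<tau> 0 = []"
    using set[of _ 0] assms(1) by (cases "\<tau> 0") auto
  moreover have "composition (\<tau> d)" for d
    using set[of 0 d] assms(1)[of d 0] by (auto simp: composition_def)
  moreover have "sorted_wrt (\<ge>) (\<tau> d)" for d
    by (simp add: \<tau>_def sorted_wrt_rev)
  moreover have "(\<Sum>i\<in>supp \<tau>. i * sum_list (\<tau> i)) = n"
    using sum_blocks[of \<tau>] assms(2) blocks by simp
  ultimately have "\<tau> \<in> Typ n"
    using fin by (simp add: Typ_def OTyp_def)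
  then show ?thesis using blocks by blast
qed

lemma tabloid_blocks:
  assumes "list_all2 (\<lambda>b D. D \<in> labeled_polywrappings b) bs T"
  defines "M \<equiv> (\<Sum>D\<leftarrow>T. blocks (psort (pocon D)))"
  shows "(\<Sum>(d, r)\<in>#M. d * r) = (\<Sum>(d, r)\<leftarrow>bs. d * r)"
    and "(d, r) \<in># M \<Longrightarrow> d > 0 \<and> r > 0"
    and "prod_list (map (\<lambda>D. etensor (pocon D)) T) = (\<Prod>(d, r)\<in>#M. elem_sym d r)"
proof -
  have "pocon D \<in> OTyp (d * r)" if "D \<in> labeled_polywrappings (d, r)" for D d r
    using that by (simp add: labeled_polywrappings_def r_OTyp_def)
  note OTyp = this
  show "(\<Sum>(d, r)\<in>#M. d * r) = (\<Sum>(d, r)\<leftarrow>bs. d * r)"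
    using assms(1) unfolding M_def
  proof (induction rule: list_all2_induct)
    case (Cons b bs D T)
    obtain d r where b: "b = (d, r)" by (cases b)
    have "(\<Sum>(d, r)\<in>#blocks (psort (pocon D)). d * r) = d * r"
      using OTyp[of D d r] Cons b by (simp add: blocks_psort sum_blocks OTyp_def)
    then show ?case using Cons b by simp
  qed simp
  show "d > 0 \<and> r > 0" if "(d, r) \<in># M"
    using assms(1) that unfolding M_def
  proof (induction rule: list_all2_induct)
    case (Cons b bs D T)
    obtain d' r' where b: "b = (d', r')" by (cases b)
    have "pocon D \<in> OTyp (d' * r')" using OTyp Cons b by simp
    then show ?case using Cons blocks_pos[of "pocon D" _ d r] by (auto simp: blocks_psort)
  qed simp
  show "prod_list (map (\<lambda>D. etensor (pocon D)) T) = (\<Prod>(d, r)\<in>#M. elem_sym d r)"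
    unfolding M_def by (induction T) (auto simp: blocks_psort etensor_eq_prod_blocks)
qed

theorem theorem69:
  fixes n :: nat and \<sigma> \<tau> :: otype and bs :: "(nat \<times> nat) list"
  assumes "n > 0"
    and "\<sigma> \<in> Typ n" and "\<tau> \<in> Typ n"
    and "mset bs = blocks \<sigma>"
  shows "etensor_coeff n (H_type \<sigma>) \<tau> = of_int (\<Sum>T\<in>tabloids bs \<tau>. psgn_tabloid bs T)"
proof -
  let ?B = "etensor ` Typ n"
  \<comment> \<open>The tabloids of the given shape with arbitrary content; the content is fixed
    only when the coefficient is read off.\<close>
  let ?A = "{T. list_all2 (\<lambda>b D. D \<in> labeled_polywrappings b) bs T}"
  let ?M = "\<lambda>T. \<Sum>D\<leftarrow>T. blocks (psort (pocon D))"
  let ?E = "\<lambda>T. prod_list (map (\<lambda>D. etensor (pocon D)) T)"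
  have finA: "finite ?A"
    by (rule finite_choices) (rule finite_labeled_polywrappings)
  have \<sigma>: "\<sigma> \<in> OTyp n" using assms(2) by (simp add: Typ_def)
  have total: "(\<Sum>(d, r)\<leftarrow>bs. d * r) = n"
  proof -
    have "(\<Sum>(d, r)\<leftarrow>bs. d * r) = (\<Sum>(d, r)\<in>#mset bs. d * r)"
      by (simp flip: sum_mset_sum_list)
    then show ?thesis
      using \<sigma> by (simp add: assms(4) sum_blocks OTyp_def)
  qed
  have pos: "snd b > 0" if "b \<in> set bs" for b
  proof -
    have "b \<in># blocks \<sigma>" using that assms(4)[symmetric] by simp
    then show ?thesis using blocks_pos(2)[OF \<sigma>, of "fst b" "snd b"] by simp
  qed
  have prod_terms: "prod_list (map2 (\<lambda>b D. of_int (psgn_lpw b D) * etensor (pocon D)) bs T) =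
      of_int (psgn_tabloid bs T) * ?E T" if "T \<in> ?A" for T
  proof -
    have "list_all2 (\<lambda>b D. D \<in> labeled_polywrappings b) bs T" using that by simp
    then show ?thesis
      unfolding psgn_tabloid_def by (induction rule: list_all2_induct) (auto simp: mult_ac)
  qed
  have "H_type \<sigma> = prod_list (map H_block bs)"
    unfolding H_type_def assms(4)[symmetric] by (simp flip: prod_mset_prod_list)
  also have "\<dots> = prod_list (map (\<lambda>b. \<Sum>D\<in>labeled_polywrappings b. of_int (psgn_lpw b D) * etensor (pocon D)) bs)"
    using pos by (intro arg_cong[where f = prod_list] map_cong refl H_block_eq_sum_labeled_polywrappings)
  also have "\<dots> = (\<Sum>T\<in>?A. prod_list (map2 (\<lambda>b D. of_int (psgn_lpw b D) * etensor (pocon D)) bs T))"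
    by (rule prod_list_sum_choices)
  also have "\<dots> = (\<Sum>T\<in>?A. mfps_scale (of_int (psgn_tabloid bs T)) (?E T))"
    by (rule sum.cong) (simp_all only: prod_terms scale_of_int)
  finally have H: "H_type \<sigma> = (\<Sum>T\<in>?A. mfps_scale (of_int (psgn_tabloid bs T)) (?E T))" .
  have E: "\<exists>\<rho>\<in>Typ n. ?E T = etensor \<rho> \<and> blocks \<rho> = ?M T" if "T \<in> ?A" for T
  proof -
    have T: "list_all2 (\<lambda>b D. D \<in> labeled_polywrappings b) bs T" using that by simp
    obtain \<rho> where "\<rho> \<in> Typ n" "blocks \<rho> = ?M T"
      using exists_type_of_blocks[of "?M T" n] tabloid_blocks(1,2)[OF T] total by auto
    then show ?thesis
      using tabloid_blocks(3)[OF T] etensor_eq_prod_blocks[of \<rho>] by (intro bexI[of _ \<rho>]) simp_all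
  qed
  have span: "?E T \<in> pseries.span ?B" if "T \<in> ?A" for T
  proof -
    obtain \<rho> where "\<rho> \<in> Typ n" "?E T = etensor \<rho>" using E \<open>T \<in> ?A\<close> by blast
    then show ?thesis by (simp add: pseries.span_base)
  qed
  have rep: "pseries.representation ?B (?E T) (etensor \<tau>) = of_bool (?M T = blocks \<tau>)" if "T \<in> ?A" for T
  proof -
    obtain \<rho> where \<rho>: "\<rho> \<in> Typ n" "?E T = etensor \<rho>" "blocks \<rho> = ?M T" using E \<open>T \<in> ?A\<close> by blast
    have "pseries.representation ?B (?E T) = (\<lambda>v. if v = etensor \<rho> then 1 else 0)"
      unfolding \<rho>(2) using \<rho>(1) by (intro pseries.representation_basis independent_etensor) auto
    \<comment> \<open>Injectivity of both \<open>etensor\<close> and \<open>blocks\<close> on types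
      turns equality of basis elements into equality of contents.\<close>
    moreover have "etensor \<tau> = etensor \<rho> \<longleftrightarrow> ?M T = blocks \<tau>"
      using inj_onD[OF inj_on_etensor, of \<tau> \<rho> n] inj_onD[OF inj_on_blocks, of \<tau> \<rho> n] \<rho> assms(3) by auto
    ultimately show ?thesis by simp
  qed
  have "etensor_coeff n (H_type \<sigma>) \<tau> =
      (\<Sum>T\<in>?A. pseries.representation ?B (mfps_scale (of_int (psgn_tabloid bs T)) (?E T)) (etensor \<tau>))"
    unfolding etensor_coeff_def H
    by (subst pseries.representation_sum) (use independent_etensor span pseries.span_scale in auto)
  also have "\<dots> = (\<Sum>T\<in>?A. of_int (psgn_tabloid bs T) * of_bool (?M T = blocks \<tau>))"
  proof (rule sum.cong)
    fix T assume T: "T \<in> ?A"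
    show "pseries.representation ?B (mfps_scale (of_int (psgn_tabloid bs T)) (?E T)) (etensor \<tau>) =
        of_int (psgn_tabloid bs T) * of_bool (?M T = blocks \<tau>)"
      using pseries.representation_scale[OF independent_etensor span[OF T]] rep[OF T] by simp
  qed simp
  also have "\<dots> = (\<Sum>T\<in>{T\<in>?A. ?M T = blocks \<tau>}. of_int (psgn_tabloid bs T))"
    unfolding sum.inter_filter[OF finA] by (rule sum.cong) auto
  also have "{T\<in>?A. ?M T = blocks \<tau>} = tabloids bs \<tau>"
    by (simp add: tabloids_def)
  finally show ?thesis by simp
qed

end
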